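(* Let $a\in\{0,1\}$ and $r\ge0$. Then $$\tfrac12\big(M_r(x)+(-1)^aM_r(-x)\big)-\delta_{r+a,0}=\sum_{\rho\in K_{2r+1}}x^{s(\rho)}\sum_{\substack{r_1+\dots+r_{f(\rho)}=r-c(\rho)\\ r_j\ge0}}\ \sum_{\mathbf v\in X^\rho_{(-1)^a}}2^{-f(\rho)}z_\rho(\mathbf v)\prod_{j=1}^{f(\rho)}\big(M_{r_j}(x)+(-1)^{v_j}M_{r_j}(-x)\big),$$ where $\delta$ is the Kronecker delta.
   Context: Permutations are words. An occurrence of $132$ in $\pi=\pi_1\cdots\pi_n$ is a triple $i<j<k$ with $\pi_i<\pi_k<\pi_j$, and $132(\pi)$ is the number of occurrences. $\operatorname{sign}(\pi)=(-1)^{\#\text{inversions}}$, and the empty permutation has sign $1$. $M_r(x)=\sum_{n\ge0}\sum_{\pi\in\mathfrak S_n,\,132(\pi)=r}\operatorname{sign}(\pi)x^n$, i.e. the generating function of even minus odd permutations with exactly $r$ occurrences of $132$. Kernel: form the bipartite graph whose vertices are the entries of $\pi$ and the occurrences of $132$ in $\pi$, an entry being joined to each occurrence containing it. The kernel of $\pi\in\mathfrak S_n$ is the subsequence of entries lying in the connected component containing the entry $n$. Its order-isomorphic permutation $\rho\in\mathfrak S_s$ is the kernel shape, with size $s(\rho)=s$ and capacity $c(\rho)=132(\rho)$. A kernel permutation is one that is the kernel shape of some permutation. $K_t$ is the set of kernel shapes of permutations in $\mathfrak S_t$. Cells: for a kernel permutation $\rho\in\mathfrak S_s$, $1\le m\le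 s$ and $1\le l\le s+1$, the cell $C_{ml}$ is the region of positions between the $(l-1)$-st and $l$-th kernel entries and values between the $(m-1)$-st and $m$-th smallest kernel entries (boundary cases: before the first or after the last kernel position; below the smallest value). $C_{ml}$ is infeasible if an element inserted into $\rho$ at a position between $\rho(l-1)$ and $\rho(l)$, with value between $m-1$ and $m$, would form a $132$ with two entries of $\rho$; otherwise it is feasible. Distinct feasible cells are linearly ordered by $C_{ml}\prec C_{m'l'}$ iff $m\ge m'$ and $l\le l'$, giving $C^1\prec\dots\prec C^{f(\rho)}$. The $k$-th kernel entry is below $C_{ml}$ if $\rho(k)<m$ and above otherwise; it is left of $C_{ml}$ if $k<l$ and right otherwise. $l_j(\rho)$ is the number of $k$ such that the $k$-th kernel entry is above-left or below-right of $C^j$. For $\mathbf v\in\{0,1\}^{f(\rho)}$, $X^\rho_\epsilon=\{\mathbf v:(-1)^{v_1+\dots+v_{f(\rho)}+s(\rho)}=\epsilon\}$ and $z_\rho(\mathbf v)=(-1)^{\sum_{i<j}v_iv_j+\sum_jl_j(\rho)v_j}\operatorname{sign}(\rho)$. *)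

theory Defs
  imports
    "HOL-Combinatorics.Multiset_Permutations"
    "HOL-Computational_Algebra.Formal_Power_Series"
    "HOL-Library.FuncSet"
begin

text \<open>
  A permutation in \<open>S\<^sub>n\<close> is a word, i.e. a list in \<open>permutations_of_set {1..n}\<close>.
  List positions count from 0, so \<open>\<pi> ! (k - 1)\<close> is the \<open>k\<close>-th entry; values and
  cell indices count from 1.
\<close>

definition occ132 :: "nat list \<Rightarrow> (nat \<times> nat \<times> nat) set" where
  "occ132 \<pi> = {(i, j, k). i < j \<and> j < k \<and> k < length \<pi> \<and> \<pi> ! i < \<pi> ! k \<and> \<pi> ! k < \<pi> ! j}"

definition num132 :: "nat list \<Rightarrow> nat" where
  "num132 \<pi> = card (occ132 \<pi>)"

definition inversions :: "nat list \<Rightarrow> (nat \<times> nat) set" where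
  "inversions \<pi> = {(i, j). i < j \<and> j < length \<pi> \<and> \<pi> ! i > \<pi> ! j}"

definition perm_sign :: "nat list \<Rightarrow> int" where
  "perm_sign \<pi> = (- 1) ^ card (inversions \<pi>)"

definition M :: "nat \<Rightarrow> rat fps" where
  "M r = Abs_fps (\<lambda>n. \<Sum>\<pi> | \<pi> \<in> permutations_of_set {1..n} \<and> num132 \<pi> = r.
            of_int (perm_sign \<pi>))"

text \<open>The bipartite graph; an entry is represented by its position.\<close>

definition occ_graph :: "nat list \<Rightarrow> ((nat + nat \<times> nat \<times> nat) \<times> (nat + nat \<times> nat \<times> nat)) set" where
  "occ_graph \<pi> = {(Inl p, Inr (i, j, k)) | p i j k. (i, j, k) \<in> occ132 \<pi> \<and> p \<in> {i, j, k}}"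

definition kernel_positions :: "nat list \<Rightarrow> nat set" where
  "kernel_positions \<pi> = {p. p < length \<pi> \<and>
     (\<exists>q < length \<pi>. \<pi> ! q = length \<pi> \<and>
        (Inl q, Inl p) \<in> (occ_graph \<pi> \<union> (occ_graph \<pi>)\<inverse>)\<^sup>*)}"

definition kernel :: "nat list \<Rightarrow> nat list" where
  "kernel \<pi> = nths \<pi> (kernel_positions \<pi>)"

text \<open>The word over \<open>{1..length xs}\<close> order-isomorphic to a word \<open>xs\<close> with distinct entries.\<close>

definition standardize :: "nat list \<Rightarrow> nat list" where
  "standardize xs = map (\<lambda>x. card {y \<in> set xs. y \<le> x}) xs"

definition kernel_shape :: "nat list \<Rightarrow> nat list" where
  "kernel_shape \<pi> = standardize (kernel \<pi>)"

definition K :: "nat \<Rightarrow> nat list set" where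
  "K t = kernel_shape ` permutations_of_set {1..t}"

abbreviation ksize :: "nat list \<Rightarrow> nat" where
  "ksize \<rho> \<equiv> length \<rho>"

abbreviation capacity :: "nat list \<Rightarrow> nat" where
  "capacity \<rho> \<equiv> num132 \<rho>"

text \<open>
  The cell \<open>C\<^bsub>ml\<^esub>\<close> is the pair \<open>(m, l)\<close>. Inserting an element into it means: the values
  \<open>\<ge> m\<close> of \<open>\<rho>\<close> are raised by one, and the value \<open>m\<close> is placed between the
  \<open>(l - 1)\<close>-st and the \<open>l\<close>-th entry, so that it has list position \<open>l - 1\<close>.
\<close>

definition insert_at_cell :: "nat list \<Rightarrow> nat \<times> nat \<Rightarrow> nat list" where
  "insert_at_cell \<rho> = (\<lambda>(m, l).
     let \<rho>' = map (\<lambda>x. if x < m then x else x + 1) \<rho>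
     in take (l - 1) \<rho>' @ m # drop (l - 1) \<rho>')"

definition infeasible :: "nat list \<Rightarrow> nat \<times> nat \<Rightarrow> bool" where
  "infeasible \<rho> C \<longleftrightarrow>
     (\<exists>(i, j, k) \<in> occ132 (insert_at_cell \<rho> C). snd C - 1 \<in> {i, j, k})"

definition feasible_cells :: "nat list \<Rightarrow> (nat \<times> nat) set" where
  "feasible_cells \<rho> = {C \<in> {1..ksize \<rho>} \<times> {1..ksize \<rho> + 1}. \<not> infeasible \<rho> C}"

definition cell_prec :: "nat \<times> nat \<Rightarrow> nat \<times> nat \<Rightarrow> bool" where
  "cell_prec = (\<lambda>(m, l) (m', l'). (m, l) \<noteq> (m', l') \<and> m \<ge> m' \<and> l \<le> l')"

text \<open>
  Being transitive and irreflexive, \<open>cell_prec\<close> admits at most one such list; it exists because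
  the feasible cells of a kernel permutation are linearly ordered.
\<close>

definition cell_list :: "nat list \<Rightarrow> (nat \<times> nat) list" where
  "cell_list \<rho> = (THE Cs. set Cs = feasible_cells \<rho> \<and> sorted_wrt cell_prec Cs)"

definition num_cells :: "nat list \<Rightarrow> nat" where
  "num_cells \<rho> = card (feasible_cells \<rho>)"

definition cell :: "nat list \<Rightarrow> nat \<Rightarrow> nat \<times> nat" where
  "cell \<rho> j = cell_list \<rho> ! (j - 1)"

definition below :: "nat list \<Rightarrow> nat \<Rightarrow> nat \<times> nat \<Rightarrow> bool" where
  "below \<rho> k = (\<lambda>(m, l). \<rho> ! (k - 1) < m)"

definition left_of :: "nat \<Rightarrow> nat \<times> nat \<Rightarrow> bool" where
  "left_of k = (\<lambda>(m, l). k < l)"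

definition l_num :: "nat list \<Rightarrow> nat \<Rightarrow> nat" where
  "l_num \<rho> j = card {k \<in> {1..ksize \<rho>}.
     (\<not> below \<rho> k (cell \<rho> j) \<and> left_of k (cell \<rho> j)) \<or>
     (below \<rho> k (cell \<rho> j) \<and> \<not> left_of k (cell \<rho> j))}"

definition X :: "nat list \<Rightarrow> int \<Rightarrow> (nat \<Rightarrow> nat) set" where
  "X \<rho> \<epsilon> = {v \<in> {1..num_cells \<rho>} \<rightarrow>\<^sub>E {0, 1}.
              (- 1) ^ ((\<Sum>j = 1..num_cells \<rho>. v j) + ksize \<rho>) = \<epsilon>}"

definition z :: "nat list \<Rightarrow> (nat \<Rightarrow> nat) \<Rightarrow> int" where
  "z \<rho> v = (- 1) ^ ((\<Sum>j = 1..num_cells \<rho>. \<Sum>i = 1..<j. v i * v j)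
                    + (\<Sum>j = 1..num_cells \<rho>. l_num \<rho> j * v j)) * perm_sign \<rho>"

text \<open>
  The tuples \<open>(r\<^sub>1, \<dots>, r\<^sub>f)\<close> with sum \<open>r - c\<close>. The integer equation
  \<open>r\<^sub>1 + \<dots> + r\<^sub>f = r - c\<close> is stated without truncated subtraction: there are none if \<open>c > r\<close>.
\<close>

definition weak_comps :: "nat \<Rightarrow> nat \<Rightarrow> nat \<Rightarrow> (nat \<Rightarrow> nat) set" where
  "weak_comps f r c = {rs \<in> {1..f} \<rightarrow>\<^sub>E UNIV. (\<Sum>j = 1..f. rs j) + c = r}"

lemma finite_weak_comps: "finite (weak_comps f r c)"
proof (rule finite_subset)
  show "weak_comps f r c \<subseteq> {1..f} \<rightarrow>\<^sub>E {..r}"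
  proof
    fix rs assume rs: "rs \<in> weak_comps f r c"
    have "rs j \<le> r" if "j \<in> {1..f}" for j
      using member_le_sum[of j "{1..f}" rs] that rs by (simp add: weak_comps_def)
    with rs show "rs \<in> {1..f} \<rightarrow>\<^sub>E {..r}"
      by (auto simp: weak_comps_def PiE_def)
  qed
qed (simp add: finite_PiE)

text \<open>The series \<open>A(-x)\<close>.\<close>

definition fps_neg_arg :: "rat fps \<Rightarrow> rat fps" where
  "fps_neg_arg A = A oo (- fps_X)"

end

theory Submission
  imports Defs "HOL-Library.Product_Lexorder"
begin

text \<open>
  A permutation is a finite set of points with two linear orders. Its kernel is the least set of
  points that contains the topmost one and contains every occurrence of 132 that it meets. Call a
  permutation that equals its own kernel a kernel permutation. In a kernel permutation, the points
  to the lower left of a feasible cell are closed under occurrences and miss the maximum, hence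
  there are none; also the points to the upper right increase. So the feasible cells form a chain
  from the upper left to the lower right, the entries of different cells are decreasing, and every
  occurrence of 132 lies in the kernel or within one cell. Hence a permutation is the same as a
  kernel permutation together with an arbitrary permutation in each feasible cell; occurrences
  add up, and the sign only depends on the signs and on the parities of the lengths, which are
  recorded by the vector \<open>v\<close>. A connected family of \<open>c\<close> triples
  covers at most \<open>2 * c + 1\<close> points, so the kernels with at most \<open>r\<close> occurrences all occur
  in \<open>K (2 * r + 1)\<close>.
\<close>

section \<open>Words of finite sets with two linear orders\<close>

text \<open>Kernel, cell contents and inflation all pick out or rearrange positions, which is
  awkward with renumbered lists. So the combinatorics takes place on point sets with arbitrary
  linearly ordered coordinates; \<open>word\<close> reads off a list and is invariant under
  \<open>order_iso\<close>. The shape of the formula comes from parities.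
  \<open>M q + (- 1) ^ v * fps_neg_arg (M q)\<close> is twice the part of \<open>M q\<close> in
  degrees of the parity of \<open>v\<close>; the factor 2^(-f) cancels one 2 per cell, and the
  vector \<open>v\<close> fixes the parity of the total length, which \<open>X\<close> compares with
  \<open>a\<close>. Letters of different cells always form an inversion, whence the products
  \<open>v i * v j\<close>; a kernel entry forms an inversion with all letters of a cell or with
  none, whence \<open>l_num\<close>. The Kronecker delta accounts for the empty permutation, which
  has no kernel. \<open>K (2 * r + 1)\<close> may contain kernels with more than \<open>r\<close>
  occurrences, but for these \<open>weak_comps\<close> is empty.\<close>

definition rank :: "('e \<Rightarrow> 'a::linorder) \<Rightarrow> 'e set \<Rightarrow> 'e \<Rightarrow> nat" where
  "rank x E e = card {e' \<in> E. x e' < x e}"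

lemma rank_mono: "finite E \<Longrightarrow> x a \<le> x b \<Longrightarrow> rank x E a \<le> rank x E b"
  unfolding rank_def by (rule card_mono) auto

lemma rank_less: "finite E \<Longrightarrow> a \<in> E \<Longrightarrow> x a < x b \<Longrightarrow> rank x E a < rank x E b"
  unfolding rank_def by (rule psubset_card_mono) auto

lemma rank_less_iff: "finite E \<Longrightarrow> a \<in> E \<Longrightarrow> rank x E a < rank x E b \<longleftrightarrow> x a < x b"
  using rank_less[of E a x b] rank_mono[of E x b a] by (meson leD leI)

lemma rank_less_card: "finite E \<Longrightarrow> a \<in> E \<Longrightarrow> rank x E a < card E"
  unfolding rank_def by (rule psubset_card_mono) auto

lemma rank_bij:
  assumes "finite E" "inj_on x E"
  shows "bij_betw (rank x E) E {..<card E}"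
proof -
  have inj: "inj_on (rank x E) E"
    using assms by (intro inj_onI) (metis inj_onD linorder_neqE nat_neq_iff rank_less)
  moreover have "rank x E ` E = {..<card E}"
    by (rule card_subset_eq) (use assms in \<open>auto simp: rank_less_card card_image[OF inj]\<close>)
  ultimately show ?thesis by (simp add: bij_betw_def)
qed

lemma rank_lessThan: "i < n \<Longrightarrow> rank (\<lambda>i. i) {..<n} i = i"
proof -
  assume "i < n"
  then have "{e' \<in> {..<n}. e' < i} = {..<i}" by auto
  then show ?thesis by (simp add: rank_def)
qed

text \<open>Positions are ranks for \<open>x\<close>, and letters are ranks for \<open>y\<close>,
  shifted by one because letters start at 1. Only relative order enters, so the coordinates may live
  in any linear orders, such as the lexicographic triples used for inflations.\<close>

definition word :: "'e set \<Rightarrow> ('e \<Rightarrow> 'a::linorder) \<Rightarrow> ('e \<Rightarrow> 'b::linorder) \<Rightarrow> nat list" where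
  "word E x y = map (\<lambda>i. Suc (rank y E (inv_into E (rank x E) i))) [0..<card E]"

definition occs :: "'e set \<Rightarrow> ('e \<Rightarrow> 'a::linorder) \<Rightarrow> ('e \<Rightarrow> 'b::linorder) \<Rightarrow> ('e \<times> 'e \<times> 'e) set" where
  "occs E x y = {(a, b, c). a \<in> E \<and> b \<in> E \<and> c \<in> E \<and> x a < x b \<and> x b < x c \<and> y a < y c \<and> y c < y b}"

definition invs :: "'e set \<Rightarrow> ('e \<Rightarrow> 'a::linorder) \<Rightarrow> ('e \<Rightarrow> 'b::linorder) \<Rightarrow> ('e \<times> 'e) set" where
  "invs E x y = {(a, b). a \<in> E \<and> b \<in> E \<and> x a < x b \<and> y b < y a}"

section \<open>Sets closed under occurrences\<close>

definition closed132 :: "'e set \<Rightarrow> ('e \<Rightarrow> 'a::linorder) \<Rightarrow> ('e \<Rightarrow> 'b::linorder) \<Rightarrow> 'e set \<Rightarrow> bool" where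
  "closed132 E x y S \<longleftrightarrow> S \<subseteq> E \<and> (\<forall>e\<in>E. (\<forall>e'\<in>E. y e' \<le> y e) \<longrightarrow> e \<in> S) \<and>
     (\<forall>(a, b, c) \<in> occs E x y. a \<in> S \<or> b \<in> S \<or> c \<in> S \<longrightarrow> a \<in> S \<and> b \<in> S \<and> c \<in> S)"

text \<open>The kernel without graphs: a connected component is the least union of components that
  contains its base point. \<open>kernel_positions_eq\<close> proves the agreement with the
  bipartite graph, whose walks are needed nowhere else.\<close>

definition core :: "'e set \<Rightarrow> ('e \<Rightarrow> 'a::linorder) \<Rightarrow> ('e \<Rightarrow> 'b::linorder) \<Rightarrow> 'e set" where
  "core E x y = \<Inter>{S. closed132 E x y S}"

lemma closed132_self: "closed132 E x y E"
  by (auto simp: closed132_def occs_def)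

lemma core_least: "closed132 E x y S \<Longrightarrow> core E x y \<subseteq> S"
  by (auto simp: core_def)

lemma core_subset: "core E x y \<subseteq> E"
  by (rule core_least[OF closed132_self])

lemma closed132_core: "closed132 E x y (core E x y)"
  unfolding closed132_def
proof (intro conjI core_subset ballI impI)
  fix e assume "e \<in> E" "\<forall>e'\<in>E. y e' \<le> y e"
  then show "e \<in> core E x y" by (auto simp: core_def closed132_def)
next
  fix t assume t: "t \<in> occs E x y"
  obtain a b c where abc: "t = (a, b, c)" by (cases t)
  have *: "a \<in> S \<and> b \<in> S \<and> c \<in> S"
    if "a \<in> core E x y \<or> b \<in> core E x y \<or> c \<in> core E x y" "closed132 E x y S" for S
  proof -
    have "a \<in> S \<or> b \<in> S \<or> c \<in> S" using that by (auto simp: core_def)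
    then show ?thesis using that(2) t unfolding abc closed132_def by blast
  qed
  have "a \<in> core E x y \<and> b \<in> core E x y \<and> c \<in> core E x y"
    if "a \<in> core E x y \<or> b \<in> core E x y \<or> c \<in> core E x y"
  proof -
    have "\<And>S. closed132 E x y S \<Longrightarrow> a \<in> S \<and> b \<in> S \<and> c \<in> S" using *[OF that] .
    then show ?thesis by (simp add: core_def)
  qed
  then show "case t of (a, b, c) \<Rightarrow> a \<in> core E x y \<or> b \<in> core E x y \<or> c \<in> core E x y \<longrightarrow>
      a \<in> core E x y \<and> b \<in> core E x y \<and> c \<in> core E x y"
    unfolding abc by auto
qed

lemma closed132_top: "closed132 E x y S \<Longrightarrow> e \<in> E \<Longrightarrow> (\<And>e'. e' \<in> E \<Longrightarrow> y e' \<le> y e) \<Longrightarrow> e \<in> S"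
  by (simp add: closed132_def)

lemma closed132_occ:
  assumes "closed132 E x y S" "(a, b, c) \<in> occs E x y" "a \<in> S \<or> b \<in> S \<or> c \<in> S"
  shows "a \<in> S \<and> b \<in> S \<and> c \<in> S"
  using assms unfolding closed132_def by blast

text \<open>An occurrence in \<open>E\<close> that meets the inner core meets the outer one, hence
  lies inside it and is an occurrence there. So the inner core is already closed in
  \<open>E\<close>. This makes the word of a core a kernel permutation.\<close>

lemma core_core: "core (core E x y) x y = core E x y"
proof
  show "core E x y \<subseteq> core (core E x y) x y"
  proof (rule core_least)
    let ?C = "core E x y" and ?D = "core (core E x y) x y"
    have D: "closed132 ?C x y ?D" and C: "closed132 E x y ?C" by (rule closed132_core)+
    have sub: "?D \<subseteq> ?C" "?C \<subseteq> E" by (rule core_subset)+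
    have "e \<in> ?D" if "e \<in> E" "\<forall>e'\<in>E. y e' \<le> y e" for e
    proof -
      have "e \<in> ?C" using closed132_top[OF C that(1)] that(2) by blast
      then show ?thesis using closed132_top[OF D] that(2) sub by blast
    qed
    moreover have "a \<in> ?D \<and> b \<in> ?D \<and> c \<in> ?D"
      if "(a, b, c) \<in> occs E x y" "a \<in> ?D \<or> b \<in> ?D \<or> c \<in> ?D" for a b c
    proof -
      have "a \<in> ?C \<and> b \<in> ?C \<and> c \<in> ?C"
        using closed132_occ[OF C that(1)] that(2) sub by blast
      then have "(a, b, c) \<in> occs ?C x y" using that(1) by (auto simp: occs_def)
      from closed132_occ[OF D this that(2)] show ?thesis .
    qed
    ultimately show "closed132 E x y ?D" using sub unfolding closed132_def by blast
  qed
qed (rule core_subset)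

section \<open>Invariance under order isomorphisms\<close>

definition order_iso ::
  "('e \<Rightarrow> 'f) \<Rightarrow> 'e set \<Rightarrow> ('e \<Rightarrow> 'a::linorder) \<Rightarrow> ('e \<Rightarrow> 'b::linorder) \<Rightarrow>
    'f set \<Rightarrow> ('f \<Rightarrow> 'c::linorder) \<Rightarrow> ('f \<Rightarrow> 'd::linorder) \<Rightarrow> bool" where
  "order_iso \<phi> E x y E' x' y' \<longleftrightarrow> bij_betw \<phi> E E' \<and>
     (\<forall>a\<in>E. \<forall>b\<in>E. (x' (\<phi> a) < x' (\<phi> b) \<longleftrightarrow> x a < x b) \<and> (y' (\<phi> a) < y' (\<phi> b) \<longleftrightarrow> y a < y b))"

lemma order_iso_restrict:
  assumes "order_iso \<phi> E x y E' x' y'" "S \<subseteq> E"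
  shows "order_iso \<phi> S x y (\<phi> ` S) x' y'"
  using assms unfolding order_iso_def by (meson bij_betw_subset subset_iff)

lemma rank_image:
  assumes "inj_on \<phi> S" "\<forall>s\<in>S. x' (\<phi> s) < x' (\<phi> e) \<longleftrightarrow> x s < x e"
  shows "rank x' (\<phi> ` S) (\<phi> e) = rank x S e"
proof -
  have "{e' \<in> \<phi> ` S. x' e' < x' (\<phi> e)} = \<phi> ` {e' \<in> S. x e' < x e}"
    using assms by auto
  moreover have "inj_on \<phi> {e' \<in> S. x e' < x e}"
    using assms(1) by (rule inj_on_subset) auto
  ultimately show ?thesis by (simp add: rank_def card_image)
qed

lemma rank_iso:
  assumes "order_iso \<phi> E x y E' x' y'" "S \<subseteq> E" "e \<in> E"
  shows "rank x' (\<phi> ` S) (\<phi> e) = rank x S e" "rank y' (\<phi> ` S) (\<phi> e) = rank y S e"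
  using assms unfolding order_iso_def bij_betw_def
  by (auto intro!: rank_image inj_on_subset[of \<phi> E S])

lemma occs_iso:
  assumes "order_iso \<phi> E x y E' x' y'"
  shows "occs E' x' y' = (\<lambda>(a, b, c). (\<phi> a, \<phi> b, \<phi> c)) ` occs E x y"
proof -
  have E': "E' = \<phi> ` E" using assms by (auto simp: order_iso_def bij_betw_def)
  have "t \<in> (\<lambda>(a, b, c). (\<phi> a, \<phi> b, \<phi> c)) ` occs E x y" if t: "t \<in> occs E' x' y'" for t
  proof -
    obtain a b c where "t = (\<phi> a, \<phi> b, \<phi> c)" "a \<in> E" "b \<in> E" "c \<in> E"
      using t by (auto simp: occs_def E')
    moreover from this have "(a, b, c) \<in> occs E x y"
      using t assms by (auto simp: occs_def order_iso_def)
    ultimately show ?thesis by force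
  qed
  moreover have "(\<lambda>(a, b, c). (\<phi> a, \<phi> b, \<phi> c)) ` occs E x y \<subseteq> occs E' x' y'"
    using assms by (auto simp: occs_def order_iso_def E')
  ultimately show ?thesis by blast
qed

lemma card_occs_iso:
  assumes "order_iso \<phi> E x y E' x' y'"
  shows "card (occs E' x' y') = card (occs E x y)"
proof -
  have "inj_on \<phi> E" using assms by (auto simp: order_iso_def bij_betw_def)
  then have "inj_on (\<lambda>(a, b, c). (\<phi> a, \<phi> b, \<phi> c)) (occs E x y)"
    by (auto simp: inj_on_def occs_def)
  then show ?thesis by (simp add: occs_iso[OF assms] card_image)
qed

lemma invs_iso:
  assumes "order_iso \<phi> E x y E' x' y'"
  shows "invs E' x' y' = (\<lambda>(a, b). (\<phi> a, \<phi> b)) ` invs E x y"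
proof -
  have E': "E' = \<phi> ` E" using assms by (auto simp: order_iso_def bij_betw_def)
  have "t \<in> (\<lambda>(a, b). (\<phi> a, \<phi> b)) ` invs E x y" if t: "t \<in> invs E' x' y'" for t
  proof -
    obtain a b where "t = (\<phi> a, \<phi> b)" "a \<in> E" "b \<in> E"
      using t by (auto simp: invs_def E')
    moreover from this have "(a, b) \<in> invs E x y"
      using t assms by (auto simp: invs_def order_iso_def)
    ultimately show ?thesis by force
  qed
  moreover have "(\<lambda>(a, b). (\<phi> a, \<phi> b)) ` invs E x y \<subseteq> invs E' x' y'"
    using assms by (auto simp: invs_def order_iso_def E')
  ultimately show ?thesis by blast
qed

lemma card_invs_iso:
  assumes "order_iso \<phi> E x y E' x' y'"
  shows "card (invs E' x' y') = card (invs E x y)"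
proof -
  have "inj_on \<phi> E" using assms by (auto simp: order_iso_def bij_betw_def)
  then have "inj_on (\<lambda>(a, b). (\<phi> a, \<phi> b)) (invs E x y)"
    by (auto simp: inj_on_def invs_def)
  then show ?thesis by (simp add: invs_iso[OF assms] card_image)
qed

lemma closed132_image:
  assumes iso: "order_iso \<phi> E x y E' x' y'" and S: "closed132 E x y S"
  shows "closed132 E' x' y' (\<phi> ` S)"
  unfolding closed132_def
proof (intro conjI ballI impI)
  have inj: "inj_on \<phi> E" and E': "E' = \<phi> ` E"
    using iso by (auto simp: order_iso_def bij_betw_def)
  have sub: "S \<subseteq> E" using S by (simp add: closed132_def)
  show "\<phi> ` S \<subseteq> E'" using sub E' by auto
  show "e \<in> \<phi> ` S" if "e \<in> E'" "\<forall>e'\<in>E'. y' e' \<le> y' e" for e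
  proof -
    obtain d where d: "d \<in> E" "e = \<phi> d" using \<open>e \<in> E'\<close> E' by auto
    have "y d' \<le> y d" if "d' \<in> E" for d'
      using iso d that \<open>\<forall>e'\<in>E'. y' e' \<le> y' e\<close> E' unfolding order_iso_def
      by (metis imageI leD leI)
    then show ?thesis using S d by (auto simp: closed132_def)
  qed
  show "case t of (a, b, c) \<Rightarrow> a \<in> \<phi> ` S \<or> b \<in> \<phi> ` S \<or> c \<in> \<phi> ` S \<longrightarrow>
      a \<in> \<phi> ` S \<and> b \<in> \<phi> ` S \<and> c \<in> \<phi> ` S" if t': "t \<in> occs E' x' y'" for t
  proof -
    obtain a b c where t: "t = (\<phi> a, \<phi> b, \<phi> c)" and o: "(a, b, c) \<in> occs E x y"
      using t' unfolding occs_iso[OF iso] by fast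
    then have "a \<in> E" "b \<in> E" "c \<in> E" by (auto simp: occs_def)
    then show ?thesis
      using closed132_occ[OF S o] by (auto simp: t inj_on_image_mem_iff[OF inj _ sub])
  qed
qed

lemma order_iso_inv:
  assumes "order_iso \<phi> E x y E' x' y'"
  shows "order_iso (inv_into E \<phi>) E' x' y' E x y"
proof -
  have b: "bij_betw \<phi> E E'" using assms by (simp add: order_iso_def)
  have "\<phi> (inv_into E \<phi> e) = e" "inv_into E \<phi> e \<in> E" if "e \<in> E'" for e
    using b that by (auto simp: bij_betw_def f_inv_into_f inv_into_into)
  then show ?thesis
    using assms bij_betw_inv_into[OF b] unfolding order_iso_def by metis
qed

text \<open>One inclusion pushes a closed set forward along \<open>\<phi>\<close>; the other does
  the same along the inverse isomorphism and maps the result back.\<close>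

lemma core_iso:
  assumes iso: "order_iso \<phi> E x y E' x' y'"
  shows "core E' x' y' = \<phi> ` core E x y"
proof
  show "core E' x' y' \<subseteq> \<phi> ` core E x y"
    by (rule core_least[OF closed132_image[OF iso closed132_core]])
  have b: "bij_betw \<phi> E E'" using iso by (simp add: order_iso_def)
  have "core E x y \<subseteq> inv_into E \<phi> ` core E' x' y'"
    by (rule core_least[OF closed132_image[OF order_iso_inv[OF iso] closed132_core]])
  then have "\<phi> ` core E x y \<subseteq> \<phi> ` inv_into E \<phi> ` core E' x' y'" by blast
  also have "\<dots> = core E' x' y'"
    by (rule image_inv_into_cancel) (use b core_subset[of E' x' y'] in \<open>auto simp: bij_betw_def\<close>)
  finally show "\<phi> ` core E x y \<subseteq> core E' x' y'" .
qed

lemma length_word [simp]: "length (word E x y) = card E"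
  by (simp add: word_def)

lemma nth_word:
  assumes "finite E" "inj_on x E" "e \<in> E"
  shows "word E x y ! rank x E e = Suc (rank y E e)"
proof -
  have "inj_on (rank x E) E" using rank_bij[OF assms(1,2)] by (simp add: bij_betw_def)
  then show ?thesis using assms by (simp add: word_def rank_less_card)
qed

text \<open>The bridge between points and lists: a point set is isomorphic to the positions of its
  own word, so statistics defined on lists can be computed on the points.\<close>

lemma word_iso_rank:
  assumes "finite E" "inj_on x E"
  shows "order_iso (rank x E) E x y {..<card E} (\<lambda>i. i) (nth (word E x y))"
  using assms by (simp add: order_iso_def rank_bij nth_word rank_less_iff)

lemma word_iso:
  assumes iso: "order_iso \<phi> E x y E' x' y'" and "finite E" "inj_on x E" "inj_on x' E'"
  shows "word E' x' y' = word E x y"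
proof (rule nth_equalityI)
  have b: "bij_betw \<phi> E E'" using iso by (simp add: order_iso_def)
  have E': "\<phi> ` E = E'" "finite E'" and card: "card E' = card E"
    using b assms(2) bij_betw_same_card[OF b] bij_betw_finite[OF b] by (auto simp: bij_betw_def)
  show "length (word E' x' y') = length (word E x y)" by (simp add: card)
  fix i assume "i < length (word E' x' y')"
  then have "i \<in> rank x E ` E"
    using rank_bij[OF assms(2,3)] card by (simp add: bij_betw_def)
  then obtain e where e: "e \<in> E" "i = rank x E e" by auto
  have "rank x' E' (\<phi> e) = rank x E e" "rank y' E' (\<phi> e) = rank y E e"
    using rank_iso[OF iso order_refl e(1)] E' by auto
  then show "word E' x' y' ! i = word E x y ! i"
    using nth_word[OF assms(2,3) e(1), of y] nth_word[OF E'(2) assms(4), of "\<phi> e" y'] e E' by auto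
qed

section \<open>Permutations as words, and their kernels as cores\<close>

definition is_perm :: "nat list \<Rightarrow> bool" where
  "is_perm \<pi> \<longleftrightarrow> \<pi> \<in> permutations_of_set {1..length \<pi>}"

lemma is_perm_iff: "is_perm \<pi> \<longleftrightarrow> set \<pi> = {1..length \<pi>}"
  by (auto simp: is_perm_def permutations_of_set_def intro: card_distinct)

lemma is_perm_inj: "is_perm \<pi> \<Longrightarrow> inj_on (nth \<pi>) {..<length \<pi>}"
  by (auto simp: is_perm_def permutations_of_set_def intro: inj_on_nth)

lemma is_perm_image: "is_perm \<pi> \<Longrightarrow> nth \<pi> ` {..<length \<pi>} = {1..length \<pi>}"
  by (auto simp: is_perm_def permutations_of_set_def set_conv_nth image_def)

lemma is_perm_bounds: "is_perm \<pi> \<Longrightarrow> i < length \<pi> \<Longrightarrow> 1 \<le> \<pi> ! i \<and> \<pi> ! i \<le> length \<pi>"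
  using is_perm_image[of \<pi>] by auto

lemma is_perm_word:
  assumes "finite E" "inj_on x E" "inj_on y E"
  shows "is_perm (word E x y)"
proof -
  have "set (word E x y) = (\<lambda>e. Suc (rank y E e)) ` inv_into E (rank x E) ` {..<card E}"
    by (auto simp: word_def)
  also have "inv_into E (rank x E) ` {..<card E} = E"
    using bij_betw_inv_into[OF rank_bij[OF assms(1,2)]] by (simp add: bij_betw_def)
  also have "(\<lambda>e. Suc (rank y E e)) ` E = Suc ` rank y E ` E" by auto
  also have "rank y E ` E = {..<card E}"
    using rank_bij[OF assms(1,3)] by (simp add: bij_betw_def)
  also have "Suc ` {..<card E} = {1..card E}"
    by (simp add: lessThan_atLeast0 atLeastLessThanSuc_atLeastAtMost)
  finally show ?thesis by (simp add: is_perm_iff)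
qed

lemma card_less_perm:
  assumes "is_perm \<pi>" "m \<le> length \<pi> + 1" "1 \<le> m"
  shows "card {i. i < length \<pi> \<and> \<pi> ! i < m} = m - 1"
proof -
  have "card {i. i < length \<pi> \<and> \<pi> ! i < m} = card (nth \<pi> ` {i. i < length \<pi> \<and> \<pi> ! i < m})"
    by (rule card_image[symmetric], rule inj_on_subset[OF is_perm_inj[OF assms(1)]]) auto
  also have "nth \<pi> ` {i. i < length \<pi> \<and> \<pi> ! i < m} = {1..<m}"
  proof -
    have "nth \<pi> ` {i. i < length \<pi> \<and> \<pi> ! i < m} = nth \<pi> ` {..<length \<pi>} \<inter> {..<m}" by auto
    then show ?thesis using assms by (auto simp: is_perm_image)
  qed
  finally show ?thesis by simp
qed

lemma rank_perm:
  assumes "is_perm \<pi>" "i < length \<pi>"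
  shows "rank (nth \<pi>) {..<length \<pi>} i = \<pi> ! i - 1"
proof -
  have "{e' \<in> {..<length \<pi>}. \<pi> ! e' < \<pi> ! i} = {e'. e' < length \<pi> \<and> \<pi> ! e' < \<pi> ! i}" by auto
  then show ?thesis
    using card_less_perm[OF assms(1), of "\<pi> ! i"] is_perm_bounds[OF assms] by (simp add: rank_def)
qed

lemma word_perm:
  assumes "is_perm \<pi>"
  shows "word {..<length \<pi>} (\<lambda>i. i) (nth \<pi>) = \<pi>"
proof (rule nth_equalityI)
  fix i assume "i < length (word {..<length \<pi>} (\<lambda>i. i) (nth \<pi>))"
  then have i: "i < length \<pi>" by simp
  then show "word {..<length \<pi>} (\<lambda>i. i) (nth \<pi>) ! i = \<pi> ! i"
    using nth_word[of "{..<length \<pi>}" "\<lambda>i. i" i "nth \<pi>"] rank_perm[OF assms i]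
      is_perm_bounds[OF assms i] by (simp add: rank_lessThan)
qed simp

lemma num132_eq: "num132 \<pi> = card (occs {..<length \<pi>} (\<lambda>i. i) (nth \<pi>))"
  unfolding num132_def occ132_def occs_def by (rule arg_cong[where f = card]) auto

lemma occ132_eq: "occ132 \<pi> = occs {..<length \<pi>} (\<lambda>i. i) (nth \<pi>)"
  unfolding occ132_def occs_def by auto

lemma inversions_eq: "inversions \<pi> = invs {..<length \<pi>} (\<lambda>i. i) (nth \<pi>)"
  unfolding inversions_def invs_def by auto

lemma num132_word:
  assumes "finite E" "inj_on x E"
  shows "num132 (word E x y) = card (occs E x y)"
  using card_occs_iso[OF word_iso_rank[OF assms]] by (simp add: num132_eq)

lemma inversions_word:
  assumes "finite E" "inj_on x E"
  shows "card (inversions (word E x y)) = card (invs E x y)"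
  using card_invs_iso[OF word_iso_rank[OF assms]] by (simp add: inversions_eq)

lemma nths_eq_map: "nths xs A = map (nth xs) (filter (\<lambda>i. i \<in> A) [0..<length xs])"
proof -
  have "zip xs [0..<length xs] = map (\<lambda>i. (xs ! i, i)) [0..<length xs]"
    by (rule nth_equalityI) auto
  then show ?thesis by (simp add: nths_def filter_map o_def)
qed

lemma standardize_nths:
  assumes "is_perm \<pi>" "S \<subseteq> {..<length \<pi>}"
  shows "standardize (nths \<pi> S) = word S (\<lambda>i. i) (nth \<pi>)"
proof (rule nth_equalityI)
  let ?L = "filter (\<lambda>i. i \<in> S) [0..<length \<pi>]"
  have set_L: "set ?L = S" and dist: "distinct ?L" using assms(2) by auto
  have len: "length ?L = card S" using distinct_card[OF dist] set_L by simp
  have sorted: "sorted_wrt (<) ?L" by (intro sorted_wrt_filter) simp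
  have fin: "finite S" using set_L by (metis List.finite_set)
  have inj: "inj_on (nth \<pi>) S" using is_perm_inj[OF assms(1)] assms(2) by (rule inj_on_subset)
  have nths: "nths \<pi> S = map (nth \<pi>) ?L" by (rule nths_eq_map)
  show "length (standardize (nths \<pi> S)) = length (word S (\<lambda>i. i) (nth \<pi>))"
    by (simp add: standardize_def nths len)
  fix i assume "i < length (standardize (nths \<pi> S))"
  then have i: "i < length ?L" by (simp add: standardize_def nths)
  define p where "p = ?L ! i"
  have p: "p \<in> S" using i set_L nth_mem p_def by blast
  \<comment> \<open>\<open>?L\<close> lists \<open>S\<close> increasingly, so the elements of
    \<open>S\<close> before \<open>p\<close> are its first \<open>i\<close> entries, and
    \<open>p\<close> has rank \<open>i\<close>.\<close>
  have "{q \<in> S. q < p} = (nth ?L) ` {..<i}"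
  proof -
    have "q \<in> (nth ?L) ` {..<i}" if q: "q \<in> S" "q < p" for q
    proof -
      obtain j where j: "j < length ?L" "q = ?L ! j" using q(1) set_L in_set_conv_nth[of q ?L] by metis
      have "j < i"
      proof (rule ccontr)
        assume "\<not> j < i"
        then have "i = j \<or> i < j" by auto
        then have "p \<le> q" using sorted_wrt_nth_less[OF sorted, of i j] j p_def by auto
        then show False using q(2) by simp
      qed
      then show ?thesis using j by auto
    qed
    moreover have "?L ! j \<in> S \<and> ?L ! j < p" if "j < i" for j
      using sorted_wrt_nth_less[OF sorted that i] that i set_L nth_mem[of j ?L] p_def by auto
    ultimately show ?thesis by auto
  qed
  then have rk: "rank (\<lambda>i. i) S p = i"
    using i inj_on_nth[OF dist, of "{..<i}"] by (simp add: rank_def card_image)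
  have "standardize (nths \<pi> S) ! i = card {v \<in> nth \<pi> ` S. v \<le> \<pi> ! p}"
    using i set_L by (simp add: standardize_def nths p_def)
  \<comment> \<open>\<open>standardize\<close> counts with \<open>\<le>\<close>, \<open>rank\<close>
    with \<open><\<close>; the point \<open>p\<close> itself makes up the difference and becomes the
    \<open>Suc\<close> in \<open>word\<close>.\<close>
  also have "{v \<in> nth \<pi> ` S. v \<le> \<pi> ! p} = nth \<pi> ` insert p {e \<in> S. \<pi> ! e < \<pi> ! p}"
    using p inj by (force simp: inj_on_def order_le_less)
  also have "card \<dots> = card (insert p {e \<in> S. \<pi> ! e < \<pi> ! p})"
    by (rule card_image, rule inj_on_subset[OF inj]) (use p in auto)
  also have "\<dots> = Suc (rank (nth \<pi>) S p)" using fin by (simp add: rank_def)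
  also have "\<dots> = word S (\<lambda>i. i) (nth \<pi>) ! i"
    using nth_word[OF fin inj_on_id2 p, of "nth \<pi>"] rk by simp
  finally show "standardize (nths \<pi> S) ! i = word S (\<lambda>i. i) (nth \<pi>) ! i" .
qed

lemma kernel_positions_eq:
  assumes "is_perm \<pi>"
  shows "kernel_positions \<pi> = core {..<length \<pi>} (\<lambda>i. i) (nth \<pi>)" (is "_ = ?C")
proof
  let ?R = "occ_graph \<pi> \<union> (occ_graph \<pi>)\<inverse>"
  have C: "closed132 {..<length \<pi>} (\<lambda>i. i) (nth \<pi>) ?C" by (rule closed132_core)
  show "kernel_positions \<pi> \<subseteq> ?C"
  proof
    fix p assume "p \<in> kernel_positions \<pi>"
    then obtain q where q: "q < length \<pi>" "\<pi> ! q = length \<pi>" "(Inl q, Inl p) \<in> ?R\<^sup>*"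
      by (auto simp: kernel_positions_def)
    have qC: "q \<in> ?C" using C q is_perm_bounds[OF assms] by (auto simp: closed132_def)
    \<comment> \<open>The invariant along a walk has to cover both sorts of vertices: a visited
      entry lies in the core, and a visited occurrence has all its three entries there.\<close>
    let ?P = "\<lambda>n. case n of Inl p \<Rightarrow> p \<in> ?C
        | Inr (i, j, k) \<Rightarrow> (i, j, k) \<in> occ132 \<pi> \<and> i \<in> ?C \<and> j \<in> ?C \<and> k \<in> ?C"
    have "?P n" if "(Inl q, n) \<in> ?R\<^sup>*" for n
      using that
    proof (induction rule: rtrancl_induct)
      case base
      show ?case using qC by simp
    next
      case (step n n')
      from step.hyps(2) consider (up) p i j k where "n = Inl p" "n' = Inr (i, j, k)" "(i, j, k) \<in> occ132 \<pi>" "p \<in> {i, j, k}"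
        | (down) p i j k where "n' = Inl p" "n = Inr (i, j, k)" "p \<in> {i, j, k}"
        unfolding occ_graph_def by blast
      then show ?case
      proof cases
        case up
        then show ?thesis using closed132_occ[OF C, of i j k] step.IH occ132_eq by auto
      next
        case down
        then show ?thesis using step.IH by auto
      qed
    qed
    from this[OF q(3)] show "p \<in> ?C" by simp
  qed
  show "?C \<subseteq> kernel_positions \<pi>"
  proof (rule core_least, unfold closed132_def, intro conjI ballI impI)
    show "kernel_positions \<pi> \<subseteq> {..<length \<pi>}" by (auto simp: kernel_positions_def)
    fix e assume e: "e \<in> {..<length \<pi>}" "\<forall>e'\<in>{..<length \<pi>}. \<pi> ! e' \<le> \<pi> ! e"
    then have "length \<pi> \<in> nth \<pi> ` {..<length \<pi>}" using is_perm_image[OF assms] by auto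
    then have "\<pi> ! e = length \<pi>" using e is_perm_bounds[OF assms, of e] by force
    then show "e \<in> kernel_positions \<pi>" using e by (auto simp: kernel_positions_def)
  next
    fix t assume "t \<in> occs {..<length \<pi>} (\<lambda>i. i) (nth \<pi>)"
    then obtain i j k where t: "t = (i, j, k)" "(i, j, k) \<in> occ132 \<pi>" by (cases t) (auto simp: occ132_eq)
    \<comment> \<open>Two entries of one occurrence are joined by a walk of two edges through that
      occurrence, so the kernel positions form a closed set.\<close>
    have e: "(Inl p, Inl p') \<in> ?R\<^sup>*" if "p \<in> {i, j, k}" "p' \<in> {i, j, k}" for p p'
    proof -
      have "(Inl p, Inr (i, j, k)) \<in> ?R" "(Inr (i, j, k), Inl p') \<in> ?R"
        using that t by (auto simp: occ_graph_def)
      then show ?thesis by (meson r_into_rtrancl rtrancl.rtrancl_into_rtrancl)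
    qed
    have "p' \<in> kernel_positions \<pi>" if "p \<in> {i, j, k}" "p' \<in> {i, j, k}" "p \<in> kernel_positions \<pi>" for p p'
    proof -
      have "p' < length \<pi>" using that(2) t by (auto simp: occ132_def)
      then show ?thesis using that(3) e[OF that(1,2)] unfolding kernel_positions_def
        by (blast intro: rtrancl_trans)
    qed
    then show "case t of (a, b, c) \<Rightarrow> a \<in> kernel_positions \<pi> \<or> b \<in> kernel_positions \<pi> \<or> c \<in> kernel_positions \<pi> \<longrightarrow>
      a \<in> kernel_positions \<pi> \<and> b \<in> kernel_positions \<pi> \<and> c \<in> kernel_positions \<pi>"
      unfolding t(1) by blast
  qed
qed

lemma kernel_shape_eq:
  assumes "is_perm \<pi>"
  shows "kernel_shape \<pi> = word (core {..<length \<pi>} (\<lambda>i. i) (nth \<pi>)) (\<lambda>i. i) (nth \<pi>)"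
  unfolding kernel_shape_def kernel_def kernel_positions_eq[OF assms]
  by (rule standardize_nths[OF assms core_subset])

section \<open>Feasible cells of a kernel permutation\<close>

text \<open>An intrinsic form of being a kernel shape; \<open>K_eq\<close> shows that up to length
  \<open>t\<close> these are exactly the shapes in \<open>K t\<close>. The empty word is excluded by
  hand, since its core is trivially everything.\<close>

definition kernel_perm :: "nat list \<Rightarrow> bool" where
  "kernel_perm \<rho> \<longleftrightarrow> is_perm \<rho> \<and> \<rho> \<noteq> [] \<and>
     core {..<length \<rho>} (\<lambda>i. i) (nth \<rho>) = {..<length \<rho>}"

lemma core_nonempty:
  assumes "finite E" "E \<noteq> {}"
  shows "core E x y \<noteq> {}"
proof -
  have "Max (y ` E) \<in> y ` E" using assms by (intro Max_in) auto
  then obtain e where "e \<in> E" "y e = Max (y ` E)" by (auto elim!: imageE)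
  then have "e \<in> core E x y"
    by (intro closed132_top[OF closed132_core]) (auto simp: assms(1))
  then show ?thesis by auto
qed

lemma kernel_perm_word_core:
  assumes "finite E" "inj_on x E" "inj_on y E" "E \<noteq> {}"
  shows "kernel_perm (word (core E x y) x y)"
proof -
  let ?C = "core E x y"
  have C: "finite ?C" "inj_on x ?C" "inj_on y ?C"
    using assms core_subset[of E x y] by (auto intro: finite_subset inj_on_subset)
  have "core {..<card ?C} (\<lambda>i. i) (nth (word ?C x y)) = rank x ?C ` ?C"
    using core_iso[OF word_iso_rank[OF C(1,2)], of y] by (simp add: core_core)
  also have "\<dots> = {..<card ?C}" using rank_bij[OF C(1,2)] by (simp add: bij_betw_def)
  finally have "core {..<card ?C} (\<lambda>i. i) (nth (word ?C x y)) = {..<card ?C}" .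
  moreover have "card ?C \<noteq> 0" using core_nonempty[OF assms(1,4)] C(1) by simp
  then have "word ?C x y \<noteq> []" by (metis length_word list.size(3))
  ultimately show ?thesis using is_perm_word[OF C] by (simp add: kernel_perm_def)
qed

lemma kernel_perm_closed:
  assumes "kernel_perm \<rho>" "closed132 {..<length \<rho>} (\<lambda>i. i) (nth \<rho>) S"
  shows "S = {..<length \<rho>}"
  using assms core_least[OF assms(2)] by (auto simp: kernel_perm_def closed132_def)

lemma nth_insert_at_cell:
  assumes "1 \<le> l" "l \<le> length \<rho> + 1" "i < length \<rho> + 1"
  shows "insert_at_cell \<rho> (m, l) ! i =
    (if i = l - 1 then m else
      let v = \<rho> ! (if i < l - 1 then i else i - 1) in if v < m then v else v + 1)"
  using assms by (auto simp: insert_at_cell_def Let_def nth_append nth_Cons' min_def)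

lemma length_insert_at_cell:
  assumes "1 \<le> l" "l \<le> length \<rho> + 1"
  shows "length (insert_at_cell \<rho> (m, l)) = length \<rho> + 1"
  using assms by (auto simp: insert_at_cell_def Let_def min_def)

text \<open>The three alternatives are the roles of the inserted element in the pattern: it is the
  1, the 3 or the 2, in this order, whence the labels \<open>one\<close>, \<open>three\<close>,
  \<open>two\<close>. Old values \<open>\<ge> m\<close> are raised, so
  \<open>m \<le> \<rho> ! j\<close> means lying above the new element; old positions
  \<open>\<ge> l - 1\<close> lie to its right.\<close>

lemma infeasible_iff:
  assumes "1 \<le> l" "l \<le> length \<rho> + 1"
  shows "infeasible \<rho> (m, l) \<longleftrightarrow>
    (\<exists>i j. l - 1 \<le> i \<and> i < j \<and> j < length \<rho> \<and> m \<le> \<rho> ! j \<and> \<rho> ! j < \<rho> ! i) \<or>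
    (\<exists>i k. i < l - 1 \<and> l - 1 \<le> k \<and> k < length \<rho> \<and> \<rho> ! i < \<rho> ! k \<and> \<rho> ! k < m) \<or>
    (\<exists>i j. i < j \<and> j < l - 1 \<and> \<rho> ! i < m \<and> m \<le> \<rho> ! j)" (is "_ \<longleftrightarrow> ?one \<or> ?three \<or> ?two")
proof
  let ?I = "insert_at_cell \<rho> (m, l)" and ?p = "l - 1"
  note nth = nth_insert_at_cell[OF assms, of _ m] and len = length_insert_at_cell[OF assms, of m]
  {
    assume "infeasible \<rho> (m, l)"
    then obtain i j k where ijk: "i < j" "j < k" "k < length \<rho> + 1" "?I ! i < ?I ! k" "?I ! k < ?I ! j"
      and p: "?p = i \<or> ?p = j \<or> ?p = k"
      by (auto simp: infeasible_def occ132_def len)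
    from p show "?one \<or> ?three \<or> ?two"
    proof (elim disjE)
      assume p: "?p = i"
      have "m < ?I ! k" "?I ! k < ?I ! j" using ijk p nth[of i] by auto
      moreover obtain j' k' where "j = Suc j'" "k = Suc k'"
        using ijk by (metis less_imp_Suc_add)
      ultimately have "?p \<le> j' \<and> j' < k' \<and> k' < length \<rho> \<and> m \<le> \<rho> ! k' \<and> \<rho> ! k' < \<rho> ! j'"
        using ijk p nth[of j] nth[of k] by (auto simp: Let_def split: if_splits)
      then show ?thesis by blast
    next
      assume p: "?p = j"
      have "?I ! i < ?I ! k" "?I ! k < m" using ijk p nth[of j] by auto
      moreover obtain k' where "k = Suc k'"
        using ijk by (metis less_imp_Suc_add)
      ultimately have "i < ?p \<and> ?p \<le> k' \<and> k' < length \<rho> \<and> \<rho> ! i < \<rho> ! k' \<and> \<rho> ! k' < m"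
        using ijk p nth[of i] nth[of k] by (auto simp: Let_def split: if_splits)
      then show ?thesis by blast
    next
      assume p: "?p = k"
      have "?I ! i < m" "m < ?I ! j" using ijk p nth[of k] by auto
      then have "i < j \<and> j < ?p \<and> \<rho> ! i < m \<and> m \<le> \<rho> ! j"
        using ijk p nth[of i] nth[of j] by (auto simp: Let_def split: if_splits)
      then show ?thesis by blast
    qed
  }
  have occ: "infeasible \<rho> (m, l)"
    if "i < j" "j < k" "k < length \<rho> + 1" "?I ! i < ?I ! k" "?I ! k < ?I ! j" "?p \<in> {i, j, k}" for i j k
    unfolding infeasible_def by (rule bexI[of _ "(i, j, k)"]) (use that in \<open>auto simp: occ132_def len\<close>)
  assume "?one \<or> ?three \<or> ?two"
  then show "infeasible \<rho> (m, l)"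
  proof (elim disjE exE conjE)
    fix i j assume "?p \<le> i" "i < j" "j < length \<rho>" "m \<le> \<rho> ! j" "\<rho> ! j < \<rho> ! i"
    then show ?thesis
      using nth[of "?p"] nth[of "i + 1"] nth[of "j + 1"] assms
      by (intro occ[of "?p" "i + 1" "j + 1"]) auto
  next
    fix i k assume "i < ?p" "?p \<le> k" "k < length \<rho>" "\<rho> ! i < \<rho> ! k" "\<rho> ! k < m"
    then show ?thesis
      using nth[of "?p"] nth[of i] nth[of "k + 1"] assms
      by (intro occ[of i "?p" "k + 1"]) auto
  next
    fix i j assume "i < j" "j < ?p" "\<rho> ! i < m" "m \<le> \<rho> ! j"
    then show ?thesis
      using nth[of "?p"] nth[of i] nth[of j] assms
      by (intro occ[of i j "?p"]) auto
  qed
qed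

lemma feasible_cells_bounds:
  "(m, l) \<in> feasible_cells \<rho> \<Longrightarrow> 1 \<le> m \<and> m \<le> length \<rho> \<and> 1 \<le> l \<and> l \<le> length \<rho> + 1"
  by (auto simp: feasible_cells_def)

text \<open>A descent to the upper right would be the 32 of an occurrence with the inserted element
  as its 1.\<close>

lemma feasible_north_east_increasing:
  assumes "is_perm \<rho>" "(m, l) \<in> feasible_cells \<rho>"
    "l - 1 \<le> i" "i < j" "j < length \<rho>" "m \<le> \<rho> ! i" "m \<le> \<rho> ! j"
  shows "\<rho> ! i < \<rho> ! j"
proof -
  note b = feasible_cells_bounds[OF assms(2)]
  have "\<not> infeasible \<rho> (m, l)" using assms(2) by (simp add: feasible_cells_def)
  then have "\<not> \<rho> ! j < \<rho> ! i" using assms infeasible_iff[of l \<rho> m] b by blast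
  moreover have "\<rho> ! i \<noteq> \<rho> ! j"
    using is_perm_inj[OF assms(1)] assms by (auto dest: inj_onD)
  ultimately show ?thesis by simp
qed

text \<open>The entries to the lower left of a feasible cell form a union of components not containing
  the maximum, so there are none.\<close>

lemma feasible_south_west_empty:
  assumes \<rho>: "kernel_perm \<rho>" and C: "(m, l) \<in> feasible_cells \<rho>" and k: "k < l - 1"
  shows "m \<le> \<rho> ! k"
proof -
  note b = feasible_cells_bounds[OF C]
  have perm: "is_perm \<rho>" using \<rho> by (simp add: kernel_perm_def)
  have inf: "\<not> infeasible \<rho> (m, l)" using C by (simp add: feasible_cells_def)
  have three: "\<And>i k. i < l - 1 \<Longrightarrow> l - 1 \<le> k \<Longrightarrow> k < length \<rho> \<Longrightarrow> \<rho> ! i < \<rho> ! k \<Longrightarrow> \<rho> ! k < m \<Longrightarrow> False"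
    and two: "\<And>i j. i < j \<Longrightarrow> j < l - 1 \<Longrightarrow> \<rho> ! i < m \<Longrightarrow> m \<le> \<rho> ! j \<Longrightarrow> False"
    using inf b infeasible_iff[of l \<rho> m] by blast+
  define SW where "SW k \<longleftrightarrow> k < l - 1 \<and> \<rho> ! k < m" for k
  let ?S = "{k. k < length \<rho> \<and> \<not> SW k}"
  have "closed132 {..<length \<rho>} (\<lambda>i. i) (nth \<rho>) ?S"
    unfolding closed132_def
  proof (intro conjI ballI impI)
    show "?S \<subseteq> {..<length \<rho>}" by auto
    \<comment> \<open>The maximum is not removed, because a cell has
      \<open>m \<le> length \<rho>\<close>.\<close>
    fix e assume e: "e \<in> {..<length \<rho>}" "\<forall>e'\<in>{..<length \<rho>}. \<rho> ! e' \<le> \<rho> ! e"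
    have "length \<rho> \<in> nth \<rho> ` {..<length \<rho>}" using is_perm_image[OF perm] b by auto
    then have "length \<rho> \<le> \<rho> ! e" using e by auto
    then show "e \<in> ?S" using e b by (auto simp: SW_def)
  next
    fix t assume "t \<in> occs {..<length \<rho>} (\<lambda>i. i) (nth \<rho>)"
    then obtain i j k where t: "t = (i, j, k)" and o: "i < j" "j < k" "k < length \<rho>" "\<rho> ! i < \<rho> ! k" "\<rho> ! k < \<rho> ! j"
      by (cases t) (auto simp: occs_def)
    \<comment> \<open>If \<open>k\<close> lies below the cell, it also lies left of it, since
      otherwise the inserted element would be the 3 between \<open>i\<close> and \<open>k\<close>;
      then \<open>j\<close> lies left as well, and below because the inserted element cannot be the
      2 after \<open>i\<close> and \<open>j\<close>. If \<open>k\<close> lies above, then so does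
      \<open>j\<close>, which is thus right of the cell, and \<open>j\<close>, \<open>k\<close> are
      a descent to the upper right.\<close>
    have "SW j \<and> SW k" if i: "SW i"
    proof -
      have j: "j < l - 1 \<Longrightarrow> \<rho> ! j < m" using two[of i j] i o unfolding SW_def by force
      show ?thesis
      proof (cases "\<rho> ! k < m")
        case True
        then have "k < l - 1" using three[of i k] i o unfolding SW_def by force
        then show ?thesis using True j o by (auto simp: SW_def)
      next
        case False
        then have "\<not> j < l - 1" using j o by auto
        moreover have "k < length \<rho>" "m \<le> \<rho> ! k" "m \<le> \<rho> ! j" using o False by auto
        ultimately show ?thesis
          using feasible_north_east_increasing[OF perm C, of j k] o by auto
      qed
    qed
    moreover have "SW i" if "SW j \<or> SW k" using that o by (auto simp: SW_def)
    ultimately show "case t of (a, b, c) \<Rightarrow> a \<in> ?S \<or> b \<in> ?S \<or> c \<in> ?S \<longrightarrow> a \<in> ?S \<and> b \<in> ?S \<and> c \<in> ?S"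
      using o(1-3) less_trans[OF o(1)] less_trans[OF o(2,3)] less_trans[OF o(1) less_trans[OF o(2,3)]]
      unfolding t prod.case mem_Collect_eq by blast
  qed
  from kernel_perm_closed[OF \<rho> this] have "?S = {..<length \<rho>}" .
  moreover have "k < length \<rho>" using k b by auto
  ultimately have "\<not> SW k" by blast
  then show ?thesis using k by (simp add: SW_def)
qed

text \<open>Suppose one cell lies strictly lower and further left than the other. The kernel entry
  just right of the first cell is left of the second, hence above it; the entry of value
  \<open>m\<close> is below the second, hence right of it. Both lie to the upper right of the first
  cell, and they descend.\<close>

lemma feasible_cells_comparable:
  assumes \<rho>: "kernel_perm \<rho>" and C: "C \<in> feasible_cells \<rho>" "C' \<in> feasible_cells \<rho>" "C \<noteq> C'"
  shows "cell_prec C C' \<or> cell_prec C' C"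
proof -
  have perm: "is_perm \<rho>" using \<rho> by (simp add: kernel_perm_def)
  have False if F: "(m, l) \<in> feasible_cells \<rho>" "(m', l') \<in> feasible_cells \<rho>" and less: "m < m'" "l < l'" for m l m' l'
  proof -
    note b = feasible_cells_bounds[OF F(1)] feasible_cells_bounds[OF F(2)]
    have k: "m' \<le> \<rho> ! (l - 1)" using feasible_south_west_empty[OF \<rho> F(2)] less b by auto
    have "m \<in> nth \<rho> ` {..<length \<rho>}" using is_perm_image[OF perm] b by auto
    then obtain p where p: "p < length \<rho>" "\<rho> ! p = m" by auto
    have "l' - 1 \<le> p" using feasible_south_west_empty[OF \<rho> F(2), of p] p less by force
    then have "l - 1 < p" using less b by linarith
    then show False
      using feasible_north_east_increasing[OF perm F(1), of "l - 1" p] k p less b by auto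
  qed
  then have *: "\<not> (fst C < fst C' \<and> snd C < snd C')" "\<not> (fst C' < fst C \<and> snd C' < snd C)"
    using C by (metis prod.collapse)+
  show ?thesis using * C(3) by (auto simp: cell_prec_def split: prod.splits)
qed

lemma cell_list_spec:
  assumes \<rho>: "kernel_perm \<rho>"
  shows "set (cell_list \<rho>) = feasible_cells \<rho> \<and> sorted_wrt cell_prec (cell_list \<rho>)"
  unfolding cell_list_def
proof (rule theI')
  let ?F = "feasible_cells \<rho>"
  \<comment> \<open>Each step along the chain raises \<open>l\<close> or lowers \<open>m\<close>, so
    \<open>g\<close> turns the relation into \<open><\<close> on numbers, from which existence and
    uniqueness of the sorted list follow. The subtraction is exact since
    \<open>m \<le> length \<rho>\<close>.\<close>
  define g where "g = (\<lambda>(m, l). l + (length \<rho> - m))"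
  have fin: "finite ?F" by (simp add: feasible_cells_def)
  have g: "g C < g C'" if "cell_prec C C'" "C \<in> ?F" "C' \<in> ?F" for C C'
    using that feasible_cells_bounds[of "fst C" "snd C" \<rho>] feasible_cells_bounds[of "fst C'" "snd C'" \<rho>]
    by (auto simp: cell_prec_def g_def split: prod.splits)
  have inj: "inj_on g ?F"
    using g feasible_cells_comparable[OF \<rho>] by (intro inj_onI) (metis less_irrefl)
  have g_iff: "cell_prec C C' \<longleftrightarrow> g C < g C'" if "C \<in> ?F" "C' \<in> ?F" for C C'
    using that g feasible_cells_comparable[OF \<rho>] by (metis less_asym less_irrefl)
  show "\<exists>!Cs. set Cs = ?F \<and> sorted_wrt cell_prec Cs"
  proof (rule ex_ex1I)
    let ?L = "map (inv_into ?F g) (sorted_list_of_set (g ` ?F))"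
    have set_L: "set ?L = ?F" using fin inj by (simp add: inj_on_def image_image cong: image_cong)
    have "sorted_wrt (<) (map g ?L)"
    proof -
      have "map g ?L = sorted_list_of_set (g ` ?F)"
        using fin by (auto intro!: map_idI simp: f_inv_into_f)
      then show ?thesis by simp
    qed
    then have "sorted_wrt (\<lambda>a b. g a < g b) ?L" by (simp only: sorted_wrt_map)
    then have "sorted_wrt cell_prec ?L"
      by (rule sorted_wrt_mono_rel[rotated]) (simp add: set_L[simplified] g_iff)
    then show "\<exists>Cs. set Cs = ?F \<and> sorted_wrt cell_prec Cs" using set_L by blast
  next
    fix L L' assume L: "set L = ?F \<and> sorted_wrt cell_prec L" "set L' = ?F \<and> sorted_wrt cell_prec L'"
    have srt: "sorted_wrt (<) (map g Cs)" if "set Cs = ?F" "sorted_wrt cell_prec Cs" for Cs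
      unfolding sorted_wrt_map by (rule sorted_wrt_mono_rel[OF _ that(2)]) (simp add: that(1) g_iff)
    have "map g L = map g L'"
      by (rule strict_sorted_equal) (use L srt in auto)
    then show "L = L'" using L inj by (auto simp: inj_on_map_eq_map)
  qed
qed

lemma cell_mono:
  assumes "kernel_perm \<rho>" "1 \<le> i" "i < j" "j \<le> num_cells \<rho>"
  shows "cell_prec (cell \<rho> i) (cell \<rho> j)"
proof -
  have s: "sorted_wrt cell_prec (cell_list \<rho>)" "set (cell_list \<rho>) = feasible_cells \<rho>"
    using cell_list_spec[OF assms(1)] by auto
  have "num_cells \<rho> \<le> length (cell_list \<rho>)"
    using card_length[of "cell_list \<rho>"] s by (simp add: num_cells_def)
  then show ?thesis
    using sorted_wrt_nth_less[OF s(1), of "i - 1" "j - 1"] assms by (auto simp: cell_def)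
qed

lemma cell_bij:
  assumes "kernel_perm \<rho>"
  shows "bij_betw (cell \<rho>) {1..num_cells \<rho>} (feasible_cells \<rho>)"
proof -
  have s: "sorted_wrt cell_prec (cell_list \<rho>)" "set (cell_list \<rho>) = feasible_cells \<rho>"
    using cell_list_spec[OF assms] by auto
  have "cell \<rho> i \<noteq> cell \<rho> j" if "1 \<le> i" "i < j" "j \<le> num_cells \<rho>" for i j
    using cell_mono[OF assms that] by (auto simp: cell_prec_def)
  then have inj: "inj_on (cell \<rho>) {1..num_cells \<rho>}"
    by (intro linorder_inj_onI) auto
  moreover have "cell \<rho> ` {1..num_cells \<rho>} = feasible_cells \<rho>"
  proof (rule card_subset_eq)
    show "finite (feasible_cells \<rho>)" by (simp add: feasible_cells_def)
    have "num_cells \<rho> \<le> length (cell_list \<rho>)"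
      using card_length[of "cell_list \<rho>"] s by (simp add: num_cells_def)
    then have "cell \<rho> i \<in> set (cell_list \<rho>)" if "1 \<le> i" "i \<le> num_cells \<rho>" for i
      unfolding cell_def by (intro nth_mem) (use that in linarith)
    then show "cell \<rho> ` {1..num_cells \<rho>} \<subseteq> feasible_cells \<rho>"
      unfolding s(2) by auto
    show "card (cell \<rho> ` {1..num_cells \<rho>}) = card (feasible_cells \<rho>)"
      using inj by (simp add: card_image num_cells_def)
  qed
  ultimately show ?thesis by (simp add: bij_betw_def)
qed

text \<open>An element to the right of and below everything takes part in no 132. So every kernel
  permutation has at least one cell where further letters can be put, as \<open>K_eq\<close>
  requires.\<close>

lemma bottom_right_feasible:
  assumes "is_perm \<rho>" "\<rho> \<noteq> []"
  shows "(1, length \<rho> + 1) \<in> feasible_cells \<rho>"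
proof -
  have "\<not> infeasible \<rho> (1, length \<rho> + 1)"
  proof
    have pos: "\<And>i. i < length \<rho> \<Longrightarrow> \<rho> ! i \<noteq> 0" using is_perm_bounds[OF assms(1)] by force
    assume "infeasible \<rho> (1, length \<rho> + 1)"
    then show False by (auto simp: infeasible_iff pos)
  qed
  then show ?thesis using assms(2) by (auto simp: feasible_cells_def Suc_le_eq)
qed

text \<open>A maximal set of occurrences whose union with the maximum has at most two new entries per
  occurrence is closed.\<close>

lemma kernel_perm_length:
  assumes \<rho>: "kernel_perm \<rho>"
  shows "length \<rho> \<le> 2 * num132 \<rho> + 1"
proof -
  have perm: "is_perm \<rho>" using \<rho> by (simp add: kernel_perm_def)
  let ?s = "length \<rho>" and ?Occ = "occ132 \<rho>"
  have fin: "finite ?Occ"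
    by (rule finite_subset[of _ "{..<?s} \<times> {..<?s} \<times> {..<?s}"]) (auto simp: occ132_def)
  have "?s \<in> nth \<rho> ` {..<?s}" using is_perm_image[OF perm] \<rho> by (auto simp: kernel_perm_def Suc_le_eq)
  then obtain q where q: "q < ?s" "\<rho> ! q = ?s" by auto
  define U where "U Q = insert q (\<Union>(i, j, k)\<in>Q. {i, j, k})" for Q :: "(nat \<times> nat \<times> nat) set"
  let ?good = "\<lambda>Q. Q \<subseteq> ?Occ \<and> card (U Q) \<le> 2 * card Q + 1"
  have "?good {}" by (simp add: U_def)
  moreover have "\<And>Q. ?good Q \<Longrightarrow> card Q \<le> card ?Occ" using fin by (auto intro: card_mono)
  ultimately have "\<exists>Q. ?good Q \<and> (\<forall>Q'. ?good Q' \<longrightarrow> card Q' \<le> card Q)"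
    by (intro ex_has_greatest_nat[of _ "{}" card "Suc (card ?Occ)"]) (auto simp: less_Suc_eq_le)
  then obtain Q where Q: "?good Q" and max: "\<And>Q'. ?good Q' \<Longrightarrow> card Q' \<le> card Q" by blast
  have finQ: "finite Q" using Q fin finite_subset by blast
  have "closed132 {..<?s} (\<lambda>i. i) (nth \<rho>) (U Q)"
    unfolding closed132_def
  proof (intro conjI ballI impI)
    show "U Q \<subseteq> {..<?s}" using Q q by (auto simp: U_def occ132_def)
    fix e assume e: "e \<in> {..<?s}" "\<forall>e'\<in>{..<?s}. \<rho> ! e' \<le> \<rho> ! e"
    then have "\<rho> ! e = \<rho> ! q" using q is_perm_bounds[OF perm, of e] by force
    then have "e = q" using is_perm_inj[OF perm] e q by (metis inj_onD lessThan_iff)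
    then show "e \<in> U Q" by (simp add: U_def)
  next
    fix t assume "t \<in> occs {..<?s} (\<lambda>i. i) (nth \<rho>)"
    then obtain i j k where t: "t = (i, j, k)" "(i, j, k) \<in> ?Occ" by (cases t) (auto simp: occ132_eq)
    have "{i, j, k} \<subseteq> U Q" if meet: "i \<in> U Q \<or> j \<in> U Q \<or> k \<in> U Q"
    proof (rule ccontr)
      assume not: "\<not> {i, j, k} \<subseteq> U Q"
      then have new: "(i, j, k) \<notin> Q" by (force simp: U_def)
      \<comment> \<open>One of the three entries is in \<open>U Q\<close> already, so the triple
        adds at most two: this is the factor 2 in the bound, and the 1 stands for the maximum at
        \<open>q\<close>.\<close>
      have "card ({i, j, k} - U Q) \<le> 2"
      proof -
        obtain u v where "{i, j, k} - U Q \<subseteq> {u, v}" using meet by blast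
        then have "card ({i, j, k} - U Q) \<le> card {u, v}" by (intro card_mono) auto
        also have "\<dots> \<le> 2" by (simp add: card_insert_if)
        finally show ?thesis .
      qed
      moreover have "U (insert (i, j, k) Q) = U Q \<union> ({i, j, k} - U Q)" by (auto simp: U_def)
      then have "card (U (insert (i, j, k) Q)) \<le> card (U Q) + card ({i, j, k} - U Q)"
        by (metis card_Un_le)
      ultimately have "?good (insert (i, j, k) Q)" using Q t(2) new finQ by auto
      from max[OF this] show False using new finQ by simp
    qed
    then show "case t of (a, b, c) \<Rightarrow> a \<in> U Q \<or> b \<in> U Q \<or> c \<in> U Q \<longrightarrow> a \<in> U Q \<and> b \<in> U Q \<and> c \<in> U Q"
      unfolding t by auto
  qed
  from kernel_perm_closed[OF \<rho> this] have "?s = card (U Q)" by simp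
  also have "\<dots> \<le> 2 * card Q + 1" using Q by blast
  also have "\<dots> \<le> 2 * num132 \<rho> + 1" using Q fin by (auto simp: num132_def intro: card_mono)
  finally show ?thesis .
qed

section \<open>Inflation\<close>

text \<open>The inflation of \<open>\<rho>\<close> by words \<open>\<tau> j\<close>, the \<open>j\<close>-th of which is placed in the \<open>j\<close>-th cell.
  The leading coordinates are odd for kernel entries and even for the other entries;
  words in the same row or column of cells are separated by the second coordinate.\<close>

type_synonym point = "nat + nat \<times> nat"

definition infl_set :: "nat list \<Rightarrow> (nat \<Rightarrow> nat list) \<Rightarrow> point set" where
  "infl_set \<rho> \<tau> = Inl ` {..<length \<rho>} \<union> Inr ` (SIGMA j:{1..num_cells \<rho>}. {..<length (\<tau> j)})"

text \<open>Entry \<open>k\<close>, counted from 0, is the \<open>(k + 1)\<close>-st one and gets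
  \<open>2 * (k + 1) + 1\<close>; column \<open>l\<close> gets \<open>2 * l\<close>, which falls
  between the entries number \<open>l - 1\<close> and \<open>l\<close>.\<close>

definition infl_x :: "nat list \<Rightarrow> point \<Rightarrow> nat \<times> nat \<times> nat" where
  "infl_x \<rho> p = (case p of Inl k \<Rightarrow> (2 * k + 3, 0, 0) | Inr (j, i) \<Rightarrow> (2 * snd (cell \<rho> j), j, i))"

text \<open>\<open>num_cells \<rho> - j\<close> reverses the order of the cells: within one row, the
  content of a cell further along the chain has to lie lower.\<close>

definition infl_y :: "nat list \<Rightarrow> (nat \<Rightarrow> nat list) \<Rightarrow> point \<Rightarrow> nat \<times> nat \<times> nat" where
  "infl_y \<rho> \<tau> p = (case p of Inl k \<Rightarrow> (2 * \<rho> ! k + 1, 0, 0)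
     | Inr (j, i) \<Rightarrow> (2 * fst (cell \<rho> j), num_cells \<rho> - j, \<tau> j ! i))"

definition inflate :: "nat list \<Rightarrow> (nat \<Rightarrow> nat list) \<Rightarrow> nat list" where
  "inflate \<rho> \<tau> = word (infl_set \<rho> \<tau>) (infl_x \<rho>) (infl_y \<rho> \<tau>)"

lemma infl_x_Inl_Inl: "infl_x \<rho> (Inl k) < infl_x \<rho> (Inl k') \<longleftrightarrow> k < k'"
  and infl_y_Inl_Inl: "infl_y \<rho> \<tau> (Inl k) < infl_y \<rho> \<tau> (Inl k') \<longleftrightarrow> \<rho> ! k < \<rho> ! k'"
  by (auto simp: infl_x_def infl_y_def less_prod_def)

lemma infl_x_Inl_Inr: "infl_x \<rho> (Inl k) < infl_x \<rho> (Inr (j, i)) \<longleftrightarrow> k + 1 < snd (cell \<rho> j)"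
  and infl_x_Inr_Inl: "infl_x \<rho> (Inr (j, i)) < infl_x \<rho> (Inl k) \<longleftrightarrow> snd (cell \<rho> j) \<le> k + 1"
  and infl_y_Inl_Inr: "infl_y \<rho> \<tau> (Inl k) < infl_y \<rho> \<tau> (Inr (j, i)) \<longleftrightarrow> \<rho> ! k < fst (cell \<rho> j)"
  and infl_y_Inr_Inl: "infl_y \<rho> \<tau> (Inr (j, i)) < infl_y \<rho> \<tau> (Inl k) \<longleftrightarrow> fst (cell \<rho> j) \<le> \<rho> ! k"
  unfolding infl_x_def infl_y_def less_prod_def by (auto; presburger)+

lemma infl_x_Inr_Inr:
  assumes "kernel_perm \<rho>" "j \<in> {1..num_cells \<rho>}" "j' \<in> {1..num_cells \<rho>}"
  shows "infl_x \<rho> (Inr (j, i)) < infl_x \<rho> (Inr (j', i')) \<longleftrightarrow> j < j' \<or> j = j' \<and> i < i'"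
  using cell_mono[OF assms(1), of j j'] cell_mono[OF assms(1), of j' j] assms(2,3)
  by (cases j j' rule: linorder_cases)
    (auto simp: infl_x_def less_prod_def cell_prec_def split: prod.splits)

lemma infl_y_Inr_Inr:
  assumes "kernel_perm \<rho>" "j \<in> {1..num_cells \<rho>}" "j' \<in> {1..num_cells \<rho>}"
  shows "infl_y \<rho> \<tau> (Inr (j, i)) < infl_y \<rho> \<tau> (Inr (j', i')) \<longleftrightarrow> j' < j \<or> j = j' \<and> \<tau> j ! i < \<tau> j ! i'"
  using cell_mono[OF assms(1), of j j'] cell_mono[OF assms(1), of j' j] assms(2,3)
  by (cases j j' rule: linorder_cases)
    (auto simp: infl_y_def less_prod_def cell_prec_def split: prod.splits)

lemmas infl_order = infl_x_Inl_Inl infl_x_Inl_Inr infl_x_Inr_Inl infl_x_Inr_Inr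
  infl_y_Inl_Inl infl_y_Inl_Inr infl_y_Inr_Inl infl_y_Inr_Inr

locale inflation =
  fixes \<rho> :: "nat list" and \<tau> :: "nat \<Rightarrow> nat list"
  assumes kernel_perm: "kernel_perm \<rho>"
    and perms: "j \<in> {1..num_cells \<rho>} \<Longrightarrow> is_perm (\<tau> j)"
begin

abbreviation "E \<equiv> infl_set \<rho> \<tau>"
abbreviation "px \<equiv> infl_x \<rho>"
abbreviation "py \<equiv> infl_y \<rho> \<tau>"
abbreviation "J \<equiv> {1..num_cells \<rho>}"

lemmas order = infl_order

lemma perm: "is_perm \<rho>" and nonempty: "\<rho> \<noteq> []"
  using kernel_perm by (simp_all add: kernel_perm_def)

lemma finite_E [simp]: "finite E"
  by (simp add: infl_set_def)

lemma E_cases: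
  assumes "p \<in> E"
  obtains k where "p = Inl k" "k < length \<rho>" | j i where "p = Inr (j, i)" "j \<in> J" "i < length (\<tau> j)"
  using assms by (auto simp: infl_set_def)

lemma inj_x: "inj_on px E"
proof (rule inj_onI)
  fix p q assume pq: "p \<in> E" "q \<in> E" and eq: "px p = px q"
  from pq have "p \<noteq> q \<Longrightarrow> px p < px q \<or> px q < px p"
    by (elim E_cases) (auto simp: order kernel_perm)
  then show "p = q" using eq by auto
qed

lemma inj_y: "inj_on py E"
proof (rule inj_onI)
  fix p q assume pq: "p \<in> E" "q \<in> E" and eq: "py p = py q"
  from pq have "p \<noteq> q \<Longrightarrow> py p < py q \<or> py q < py p"
  proof (elim E_cases, goal_cases)
    case (1 k k')
    then have "\<rho> ! k \<noteq> \<rho> ! k'" using is_perm_inj[OF perm] by (auto dest: inj_onD)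
    then show ?case using 1 by (auto simp: order)
  next
    case (4 j i j' i')
    then have "j \<noteq> j' \<or> \<tau> j ! i \<noteq> \<tau> j' ! i'"
      using is_perm_inj[OF perms[of j]] by (auto dest: inj_onD)
    then show ?case using 4 by (auto simp: order kernel_perm)
  qed (auto simp: order)
  then show "p = q" using eq by auto
qed

lemma cell_feasible: "j \<in> J \<Longrightarrow> (fst (cell \<rho> j), snd (cell \<rho> j)) \<in> feasible_cells \<rho>"
  using cell_bij[OF kernel_perm] by (auto simp: bij_betw_def)

lemma cell_bounds:
  "j \<in> J \<Longrightarrow> 1 \<le> fst (cell \<rho> j) \<and> fst (cell \<rho> j) \<le> length \<rho> \<and> 1 \<le> snd (cell \<rho> j) \<and> snd (cell \<rho> j) \<le> length \<rho> + 1"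
  using feasible_cells_bounds[OF cell_feasible] by blast

lemma south_west: "j \<in> J \<Longrightarrow> k + 1 < snd (cell \<rho> j) \<Longrightarrow> fst (cell \<rho> j) \<le> \<rho> ! k"
  by (rule feasible_south_west_empty[OF kernel_perm cell_feasible]) auto

lemma north_east:
  "j \<in> J \<Longrightarrow> snd (cell \<rho> j) \<le> k + 1 \<Longrightarrow> k < k' \<Longrightarrow> k' < length \<rho> \<Longrightarrow>
    fst (cell \<rho> j) \<le> \<rho> ! k \<Longrightarrow> fst (cell \<rho> j) \<le> \<rho> ! k' \<Longrightarrow> \<rho> ! k < \<rho> ! k'"
  by (rule feasible_north_east_increasing[OF perm cell_feasible]) auto

lemma iso_Inl: "order_iso Inl {..<length \<rho>} (\<lambda>i. i) (nth \<rho>) (Inl ` {..<length \<rho>}) px py"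
  by (auto simp: order_iso_def order bij_betw_def)

lemma iso_Inr:
  assumes "j \<in> J"
  shows "order_iso (\<lambda>i. Inr (j, i)) {..<length (\<tau> j)} (\<lambda>i. i) (nth (\<tau> j))
    ((\<lambda>i. Inr (j, i)) ` {..<length (\<tau> j)}) px py"
  using assms by (auto simp: order_iso_def order kernel_perm bij_betw_def inj_on_def)

abbreviation "triple \<phi> \<equiv> \<lambda>(a, b, c). (\<phi> a, \<phi> b, \<phi> c)"

text \<open>No letter lies to the upper right of a kernel entry, because the lower left of a cell is
  empty, and none lies to the upper right of a letter of a different cell, because cells descend. So
  an occurrence starting in the kernel stays there. One starting in cell \<open>j\<close> can leave
  it only through kernel entries: two of them would descend to the upper right of the cell, and a
  single one would have to lie horizontally or vertically between two letters of the same
  cell.\<close>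

lemma occs_inflation:
  "occs E px py = triple Inl ` occ132 \<rho> \<union> (\<Union>j\<in>J. triple (\<lambda>i. Inr (j, i)) ` occ132 (\<tau> j))"
  (is "_ = ?A \<union> ?B")
proof (intro equalityI subsetI)
  fix t assume "t \<in> occs E px py"
  then obtain a b c where t: "t = (a, b, c)" and E: "a \<in> E" "b \<in> E" "c \<in> E"
    and o: "px a < px b" "px b < px c" "py a < py c" "py c < py b"
    by (cases t) (auto simp: occs_def)
  from o have o': "px a < px c" "py a < py b" by auto
  have sw: False if "Inl k \<in> E" "Inr (j, i) \<in> E" "px (Inl k) < px (Inr (j, i))" "py (Inl k) < py (Inr (j, i))" for k j i
    using that south_west[of j k] by (auto simp: order infl_set_def)
  have Inr_j: "j = j'" if "Inr (j, i) \<in> E" "Inr (j', i') \<in> E"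
    "px (Inr (j, i)) < px (Inr (j', i'))" "py (Inr (j, i)) < py (Inr (j', i'))" for j i j' i'
    using that by (auto simp: order kernel_perm infl_set_def)
  show "t \<in> ?A \<union> ?B"
  proof (cases a)
    case a: (Inl k1)
    then obtain k2 k3 where bc: "b = Inl k2" "c = Inl k3"
      using E o o' sw by (metis old.prod.exhaust sumE)
    have "(k1, k2, k3) \<in> occ132 \<rho>"
      using E o unfolding a bc by (auto simp: occ132_def order infl_set_def)
    then show ?thesis unfolding t a bc by force
  next
    case (Inr ji)
    then obtain j i where a: "a = Inr (j, i)" by (cases ji) auto
    have j: "j \<in> J" using E a by (auto simp: infl_set_def)
    show ?thesis
    proof (cases b)
      case b: (Inl k)
      show ?thesis
      proof (cases c)
        case c: (Inl k')
        then show ?thesis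
          using north_east[OF j, of k k'] E o o' unfolding a b c by (auto simp: order infl_set_def)
      next
        case (Inr ji')
        then obtain j' i' where c: "c = Inr (j', i')" by (cases ji') auto
        have "j = j'" using Inr_j E o o' unfolding a c by blast
        then show ?thesis using o o' unfolding a b c by (auto simp: order)
      qed
    next
      case (Inr ji')
      then obtain j' i' where b: "b = Inr (j', i')" by (cases ji') auto
      have jj: "j' = j" using Inr_j[of j i j' i'] E o o' unfolding a b by blast
      show ?thesis
      proof (cases c)
        case c: (Inl k')
        then show ?thesis using o o' unfolding a b c jj by (auto simp: order)
      next
        case (Inr ji'')
        then obtain j'' i'' where c: "c = Inr (j'', i'')" by (cases ji'') auto
        have jjj: "j'' = j" using Inr_j[of j i j'' i''] E o o' unfolding a c by blast
        have "(i, i', i'') \<in> occ132 (\<tau> j)"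
          using E o unfolding a b c jj jjj by (auto simp: occ132_def order kernel_perm infl_set_def)
        then show ?thesis using j unfolding t a b c jj jjj by force
      qed
    qed
  qed
next
  fix t assume "t \<in> ?A \<union> ?B"
  then show "t \<in> occs E px py"
    by (auto simp: occs_def occ132_def order kernel_perm infl_set_def)
qed

lemma card_occs_inflation: "card (occs E px py) = num132 \<rho> + (\<Sum>j\<in>J. num132 (\<tau> j))"
proof -
  have fin: "finite (occ132 \<sigma>)" for \<sigma>
    by (rule finite_subset[of _ "{..<length \<sigma>} \<times> {..<length \<sigma>} \<times> {..<length \<sigma>}"]) (auto simp: occ132_def)
  have "card (occs E px py) = card (triple Inl ` occ132 \<rho> :: (point \<times> point \<times> point) set)
      + card (\<Union>j\<in>J. triple (\<lambda>i. Inr (j, i)) ` occ132 (\<tau> j) :: (point \<times> point \<times> point) set)"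
    unfolding occs_inflation by (rule card_Un_disjoint) (auto simp: fin)
  also have "card (triple Inl ` occ132 \<rho> :: (point \<times> point \<times> point) set) = num132 \<rho>"
    unfolding num132_def by (rule card_image) (auto simp: inj_on_def)
  also have "card (\<Union>j\<in>J. triple (\<lambda>i. Inr (j, i)) ` occ132 (\<tau> j) :: (point \<times> point \<times> point) set)
      = (\<Sum>j\<in>J. card (triple (\<lambda>i. Inr (j, i)) ` occ132 (\<tau> j) :: (point \<times> point \<times> point) set))"
    by (rule card_UN_disjoint) (auto simp: fin)
  also have "\<dots> = (\<Sum>j\<in>J. num132 (\<tau> j))"
    unfolding num132_def by (intro sum.cong refl card_image) (auto simp: inj_on_def)
  finally show ?thesis .
qed

lemma card_E: "card E = length \<rho> + (\<Sum>j\<in>J. length (\<tau> j))"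
proof -
  have "card E = card (Inl ` {..<length \<rho>} :: point set)
      + card (Inr ` (SIGMA j:J. {..<length (\<tau> j)}) :: point set)"
    unfolding infl_set_def by (rule card_Un_disjoint) auto
  then show ?thesis by (simp add: card_image)
qed

text \<open>The kernel entries are closed because no occurrence is mixed. Conversely, the core
  restricted to them is a closed set of \<open>\<rho>\<close>, and a kernel permutation has no
  proper closed subset.\<close>

lemma core_inflation: "core E px py = Inl ` {..<length \<rho>}"
proof
  have "length \<rho> \<in> nth \<rho> ` {..<length \<rho>}"
    using is_perm_image[OF perm] nonempty by (simp add: Suc_le_eq)
  then obtain q where q: "q < length \<rho>" "\<rho> ! q = length \<rho>" by auto
  show "core E px py \<subseteq> Inl ` {..<length \<rho>}"
  proof (rule core_least, unfold closed132_def, intro conjI ballI impI)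
    show "Inl ` {..<length \<rho>} \<subseteq> E" by (auto simp: infl_set_def)
    fix e assume e: "e \<in> E" "\<forall>e'\<in>E. py e' \<le> py e"
    have "Inl q \<in> E" using q by (auto simp: infl_set_def)
    \<comment> \<open>No cell lies above the maximum, as the rows satisfy
      \<open>m \<le> length \<rho>\<close>; so the topmost point is a kernel entry.\<close>
    then have "\<not> py e < py (Inl q)" using e by force
    then show "e \<in> Inl ` {..<length \<rho>}"
      using e(1) q cell_bounds by (elim E_cases) (auto simp: order)
  next
    fix t assume "t \<in> occs E px py"
    then show "case t of (a, b, c) \<Rightarrow> a \<in> Inl ` {..<length \<rho>} \<or> b \<in> Inl ` {..<length \<rho>} \<or> c \<in> Inl ` {..<length \<rho>} \<longrightarrow>
        a \<in> Inl ` {..<length \<rho>} \<and> b \<in> Inl ` {..<length \<rho>} \<and> c \<in> Inl ` {..<length \<rho>}"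
      unfolding occs_inflation by (auto simp: occ132_def)
  qed
  have "closed132 {..<length \<rho>} (\<lambda>i. i) (nth \<rho>) {k. k < length \<rho> \<and> Inl k \<in> core E px py}" (is "closed132 _ _ _ ?S")
    unfolding closed132_def
  proof (intro conjI ballI impI)
    show "?S \<subseteq> {..<length \<rho>}" by auto
    fix e assume e: "e \<in> {..<length \<rho>}" "\<forall>e'\<in>{..<length \<rho>}. \<rho> ! e' \<le> \<rho> ! e"
    then have top: "length \<rho> \<le> \<rho> ! e" using q by force
    have "Inl e \<in> core E px py"
    proof (rule closed132_top[OF closed132_core])
      show "Inl e \<in> E" using e by (auto simp: infl_set_def)
      fix e' assume "e' \<in> E"
      then have "\<not> py (Inl e) < py e'"
        using e top cell_bounds by (elim E_cases) (force simp: order)+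
      then show "py e' \<le> py (Inl e)" by simp
    qed
    then show "e \<in> ?S" using e by auto
  next
    fix t assume t: "t \<in> occs {..<length \<rho>} (\<lambda>i. i) (nth \<rho>)"
    obtain a b c where abc: "t = (a, b, c)" by (cases t)
    have "(Inl a, Inl b, Inl c) \<in> occs E px py"
      using t unfolding abc occs_inflation occ132_eq
      by (intro UnI1 image_eqI[of _ _ "(a, b, c)"]) auto
    from closed132_occ[OF closed132_core this]
    show "case t of (a, b, c) \<Rightarrow> a \<in> ?S \<or> b \<in> ?S \<or> c \<in> ?S \<longrightarrow> a \<in> ?S \<and> b \<in> ?S \<and> c \<in> ?S"
      using t unfolding abc by (auto simp: occs_def)
  qed
  from kernel_perm_closed[OF kernel_perm this]
  show "Inl ` {..<length \<rho>} \<subseteq> core E px py" by auto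
qed

text \<open>The four sets are the inversions inside the kernel, inside one cell, between two cells
  (all pairs, as the cells descend), and between kernel and cell, where \<open>k\<close> runs
  through what \<open>l_num\<close> counts, independently of the letter. In the last set the case
  distinction puts the left element of the pair first.\<close>

lemma invs_inflation:
  "invs E px py = (\<lambda>(a, b). (Inl a, Inl b)) ` inversions \<rho>
     \<union> (\<Union>j\<in>J. (\<lambda>(a, b). (Inr (j, a), Inr (j, b))) ` inversions (\<tau> j))
     \<union> (\<lambda>(j, i, b, a). (Inr (i, a), Inr (j, b))) `
         (SIGMA j:J. SIGMA i:{1..<j}. {..<length (\<tau> j)} \<times> {..<length (\<tau> i)})
     \<union> (\<lambda>(j, k, i). if left_of k (cell \<rho> j) then (Inl (k - 1), Inr (j, i)) else (Inr (j, i), Inl (k - 1))) `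
         (SIGMA j:J. {k \<in> {1..length \<rho>}. \<not> below \<rho> k (cell \<rho> j) \<and> left_of k (cell \<rho> j) \<or>
            below \<rho> k (cell \<rho> j) \<and> \<not> left_of k (cell \<rho> j)} \<times> {..<length (\<tau> j)})"
  (is "_ = ?A \<union> ?B \<union> ?C \<union> ?f ` ?D")
proof (intro equalityI subsetI)
  have bl: "below \<rho> k (cell \<rho> j) \<longleftrightarrow> \<rho> ! (k - 1) < fst (cell \<rho> j)"
    "left_of k (cell \<rho> j) \<longleftrightarrow> k < snd (cell \<rho> j)" for k j
    by (simp_all add: below_def left_of_def split: prod.splits)
  fix t assume "t \<in> invs E px py"
  then obtain a b where t: "t = (a, b)" and E: "a \<in> E" "b \<in> E" and o: "px a < px b" "py b < py a"
    by (cases t) (auto simp: invs_def)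
  from E show "t \<in> ?A \<union> ?B \<union> ?C \<union> ?f ` ?D"
  proof (elim E_cases, goal_cases)
    case (1 k k')
    then have "(k, k') \<in> inversions \<rho>" using o by (auto simp: inversions_def order)
    then show ?case using t 1 by force
  next
    case (2 k j i)
    then have "(j, k + 1, i) \<in> ?D" "?f (j, k + 1, i) = t"
      using o t by (auto simp: bl order)
    then show ?case by blast
  next
    case (3 j i k)
    then have "(j, k + 1, i) \<in> ?D" "?f (j, k + 1, i) = t"
      using o t by (auto simp: bl order)
    then show ?case by blast
  next
    case (4 j i j' i')
    show ?case
    proof (cases "j = j'")
      case True
      then have "(i, i') \<in> inversions (\<tau> j)"
        using o 4 by (auto simp: inversions_def order kernel_perm)
      then show ?thesis using t 4 True by force
    next
      case False
      then have "j < j'" using o 4 by (auto simp: order kernel_perm)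
      then show ?thesis using t 4 by (force intro!: image_eqI[of _ _ "(j', j, i', i)"])
    qed
  qed
next
  have bl: "below \<rho> k (cell \<rho> j) \<longleftrightarrow> \<rho> ! (k - 1) < fst (cell \<rho> j)"
    "left_of k (cell \<rho> j) \<longleftrightarrow> k < snd (cell \<rho> j)" for k j
    by (simp_all add: below_def left_of_def split: prod.splits)
  fix t assume "t \<in> ?A \<union> ?B \<union> ?C \<union> ?f ` ?D"
  then show "t \<in> invs E px py"
  proof (elim UnE)
    assume "t \<in> ?f ` ?D"
    then show ?thesis
      by (auto simp: invs_def bl order infl_set_def)
  qed (auto simp: invs_def inversions_def order kernel_perm infl_set_def)
qed

lemma card_invs_inflation:
  "card (invs E px py) = card (inversions \<rho>) + (\<Sum>j\<in>J. card (inversions (\<tau> j)))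
     + (\<Sum>j\<in>J. \<Sum>i=1..<j. length (\<tau> i) * length (\<tau> j)) + (\<Sum>j\<in>J. l_num \<rho> j * length (\<tau> j))"
proof -
  have fin: "finite (inversions \<sigma>)" for \<sigma>
    by (rule finite_subset[of _ "{..<length \<sigma>} \<times> {..<length \<sigma>}"]) (auto simp: inversions_def)
  let ?A = "(\<lambda>(a, b). (Inl a, Inl b)) ` inversions \<rho> :: (point \<times> point) set"
  let ?b = "\<lambda>j. (\<lambda>(a, b). (Inr (j, a), Inr (j, b))) ` inversions (\<tau> j) :: (point \<times> point) set"
  let ?c = "\<lambda>(j, i, b, a). (Inr (i, a), Inr (j, b)) :: point \<times> point"
  let ?C = "SIGMA j:J. SIGMA i:{1..<j}. {..<length (\<tau> j)} \<times> {..<length (\<tau> i)}"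
  let ?d = "\<lambda>(j, k, i). if left_of k (cell \<rho> j) then (Inl (k - 1), Inr (j, i)) else (Inr (j, i), Inl (k - 1)) :: point \<times> point"
  let ?D = "SIGMA j:J. {k \<in> {1..length \<rho>}. \<not> below \<rho> k (cell \<rho> j) \<and> left_of k (cell \<rho> j) \<or>
            below \<rho> k (cell \<rho> j) \<and> \<not> left_of k (cell \<rho> j)} \<times> {..<length (\<tau> j)}"
  have "card (invs E px py) = card (?A \<union> (\<Union>j\<in>J. ?b j) \<union> ?c ` ?C) + card (?d ` ?D)"
    unfolding invs_inflation by (rule card_Un_disjoint) (auto simp: fin split: if_splits)
  also have "card (?A \<union> (\<Union>j\<in>J. ?b j) \<union> ?c ` ?C) = card (?A \<union> (\<Union>j\<in>J. ?b j)) + card (?c ` ?C)"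
    by (rule card_Un_disjoint) (auto simp: fin)
  also have "card (?A \<union> (\<Union>j\<in>J. ?b j)) = card ?A + card (\<Union>j\<in>J. ?b j)"
    by (rule card_Un_disjoint) (auto simp: fin)
  also have "card ?A = card (inversions \<rho>)" by (rule card_image) (auto simp: inj_on_def)
  also have "card (\<Union>j\<in>J. ?b j) = (\<Sum>j\<in>J. card (?b j))"
    by (rule card_UN_disjoint) (auto simp: fin)
  also have "\<dots> = (\<Sum>j\<in>J. card (inversions (\<tau> j)))"
    by (intro sum.cong refl card_image) (auto simp: inj_on_def)
  also have "card (?c ` ?C) = card ?C" by (rule card_image) (auto simp: inj_on_def)
  also have "\<dots> = (\<Sum>j\<in>J. \<Sum>i=1..<j. length (\<tau> i) * length (\<tau> j))"
    by (simp add: mult.commute)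
  also have "card (?d ` ?D) = card ?D"
    by (rule card_image) (auto simp: inj_on_def split: if_splits)
  also have "\<dots> = (\<Sum>j\<in>J. l_num \<rho> j * length (\<tau> j))"
    by (simp add: l_num_def)
  finally show ?thesis .
qed

lemma length_inflate: "length (inflate \<rho> \<tau>) = length \<rho> + (\<Sum>j\<in>J. length (\<tau> j))"
  by (simp add: inflate_def card_E)

lemma is_perm_inflate: "is_perm (inflate \<rho> \<tau>)"
  unfolding inflate_def by (rule is_perm_word[OF finite_E inj_x inj_y])

lemma num132_inflate: "num132 (inflate \<rho> \<tau>) = num132 \<rho> + (\<Sum>j\<in>J. num132 (\<tau> j))"
  by (simp add: inflate_def num132_word inj_x card_occs_inflation)

lemma perm_sign_inflate:
  "perm_sign (inflate \<rho> \<tau>) = perm_sign \<rho> * (\<Prod>j\<in>J. perm_sign (\<tau> j)) *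
     (- 1) ^ ((\<Sum>j\<in>J. \<Sum>i=1..<j. length (\<tau> i) * length (\<tau> j)) + (\<Sum>j\<in>J. l_num \<rho> j * length (\<tau> j)))"
  by (simp add: perm_sign_def inflate_def inversions_word inj_x card_invs_inflation power_add power_sum)

end

section \<open>Decomposition along the kernel\<close>

text \<open>The \<open>Suc\<close> matches the numbering of cells: with \<open>l - 1\<close> core
  points to its left, an element stands between the core points number \<open>l - 1\<close> and
  \<open>l\<close>; likewise for values.\<close>

definition cell_of :: "'e set \<Rightarrow> ('e \<Rightarrow> 'a::linorder) \<Rightarrow> ('e \<Rightarrow> 'b::linorder) \<Rightarrow> 'e \<Rightarrow> nat \<times> nat" where
  "cell_of E x y e = (Suc (rank y (core E x y) e), Suc (rank x (core E x y) e))"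

definition cell_part :: "'e set \<Rightarrow> ('e \<Rightarrow> 'a::linorder) \<Rightarrow> ('e \<Rightarrow> 'b::linorder) \<Rightarrow> nat \<times> nat \<Rightarrow> 'e set" where
  "cell_part E x y C = {e \<in> E - core E x y. cell_of E x y e = C}"

text \<open>Restricted to the cell indices, so that it belongs to a \<open>PiE\<close> set and the
  correspondence with fillings is one-to-one.\<close>

definition cell_words :: "nat list \<Rightarrow> nat \<Rightarrow> nat list" where
  "cell_words \<pi> = (\<lambda>j \<in> {1..num_cells (kernel_shape \<pi>)}.
     word (cell_part {..<length \<pi>} (\<lambda>i. i) (nth \<pi>) (cell (kernel_shape \<pi>) j)) (\<lambda>i. i) (nth \<pi>))"

lemma cell_part_iso:
  assumes iso: "order_iso \<phi> E x y E' x' y'"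
  shows "cell_part E' x' y' C = \<phi> ` cell_part E x y C"
proof -
  have b: "inj_on \<phi> E" "E' = \<phi> ` E" using iso by (auto simp: order_iso_def bij_betw_def)
  have mem: "\<phi> e \<in> \<phi> ` core E x y \<longleftrightarrow> e \<in> core E x y" if "e \<in> E" for e
    using inj_on_image_mem_iff[OF b(1) that core_subset] .
  have cell: "cell_of E' x' y' (\<phi> e) = cell_of E x y e" if "e \<in> E" for e
    using rank_iso[OF iso core_subset[of E x y] that] by (simp add: cell_of_def core_iso[OF iso])
  have "cell_part E' x' y' C = {e \<in> \<phi> ` E - \<phi> ` core E x y. cell_of E' x' y' e = C}"
    by (simp only: cell_part_def core_iso[OF iso] b(2)[symmetric])
  also have "\<dots> = \<phi> ` {e \<in> E. \<phi> e \<notin> \<phi> ` core E x y \<and> cell_of E' x' y' (\<phi> e) = C}"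
    by auto
  also have "{e \<in> E. \<phi> e \<notin> \<phi> ` core E x y \<and> cell_of E' x' y' (\<phi> e) = C} = cell_part E x y C"
    unfolding cell_part_def by (rule Collect_cong) (metis Diff_iff mem cell)
  finally show ?thesis .
qed

lemma cell_part_subset: "cell_part E x y C \<subseteq> E"
  by (auto simp: cell_part_def)

lemma kernel_shape_word:
  assumes "finite E" "inj_on x E" "inj_on y E"
  shows "kernel_shape (word E x y) = word (core E x y) x y"
proof -
  note iso = word_iso_rank[OF assms(1,2), of y]
  have "kernel_shape (word E x y) =
      word (core {..<card E} (\<lambda>i. i) (nth (word E x y))) (\<lambda>i. i) (nth (word E x y))"
    using kernel_shape_eq[OF is_perm_word[OF assms]] by simp
  also have "\<dots> = word (core E x y) x y"
    unfolding core_iso[OF iso]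
    by (rule word_iso[OF order_iso_restrict[OF iso core_subset]])
      (use assms core_subset[of E x y] in \<open>auto intro: finite_subset inj_on_subset\<close>)
  finally show ?thesis .
qed

lemma cell_words_word:
  assumes "finite E" "inj_on x E" "inj_on y E"
  defines "\<rho> \<equiv> word (core E x y) x y"
  shows "cell_words (word E x y) = (\<lambda>j \<in> {1..num_cells \<rho>}. word (cell_part E x y (cell \<rho> j)) x y)"
proof -
  note iso = word_iso_rank[OF assms(1,2), of y]
  have "word (cell_part {..<card E} (\<lambda>i. i) (nth (word E x y)) C) (\<lambda>i. i) (nth (word E x y)) =
      word (cell_part E x y C) x y" for C
    unfolding cell_part_iso[OF iso]
    by (rule word_iso[OF order_iso_restrict[OF iso cell_part_subset]])
      (use assms(1,2) cell_part_subset[of E x y C] in \<open>auto intro: finite_subset inj_on_subset\<close>)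
  then show ?thesis
    by (simp add: cell_words_def kernel_shape_word[OF assms(1-3)] \<rho>_def)
qed

context inflation
begin

lemma word_core_inflation: "word (core E px py) px py = \<rho>"
proof -
  have "word (core E px py) px py = word {..<length \<rho>} (\<lambda>i. i) (nth \<rho>)"
    unfolding core_inflation
    by (rule word_iso[OF iso_Inl])
      (use inj_x core_subset[of E px py] in \<open>auto simp: core_inflation intro: inj_on_subset\<close>)
  then show ?thesis by (simp add: word_perm[OF perm])
qed

lemma cell_of_inflation:
  assumes "j \<in> J"
  shows "cell_of E px py (Inr (j, i)) = cell \<rho> j"
proof -
  have "{e' \<in> Inl ` {..<length \<rho>}. px e' < px (Inr (j, i))} = Inl ` {..<snd (cell \<rho> j) - 1}"
    using cell_bounds[OF assms] by (auto simp: order)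
  then have x: "rank px (Inl ` {..<length \<rho>}) (Inr (j, i)) = snd (cell \<rho> j) - 1"
    by (simp add: rank_def card_image)
  have "{e' \<in> Inl ` {..<length \<rho>}. py e' < py (Inr (j, i))} =
      Inl ` {k. k < length \<rho> \<and> \<rho> ! k < fst (cell \<rho> j)}"
    by (auto simp: order)
  then have "rank py (Inl ` {..<length \<rho>}) (Inr (j, i)) = card {k. k < length \<rho> \<and> \<rho> ! k < fst (cell \<rho> j)}"
    by (simp add: rank_def card_image)
  also have "\<dots> = fst (cell \<rho> j) - 1"
    using cell_bounds[OF assms] by (intro card_less_perm[OF perm]) auto
  finally show ?thesis
    using x cell_bounds[OF assms] by (simp add: cell_of_def core_inflation prod_eq_iff)
qed

lemma word_cell_part_inflation:
  assumes "j \<in> J"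
  shows "word (cell_part E px py (cell \<rho> j)) px py = \<tau> j"
proof -
  have inj: "inj_on (cell \<rho>) J" using cell_bij[OF kernel_perm] by (simp add: bij_betw_def)
  have "e \<in> (\<lambda>i. Inr (j, i)) ` {..<length (\<tau> j)}" if "e \<in> cell_part E px py (cell \<rho> j)" for e
  proof -
    have e: "e \<in> E" "e \<notin> Inl ` {..<length \<rho>}" "cell_of E px py e = cell \<rho> j"
      using that by (auto simp: cell_part_def core_inflation)
    from e(1) show ?thesis
    proof (cases rule: E_cases)
      case (2 j' i)
      then have "j' = j" using e(3) assms inj by (auto simp: cell_of_inflation inj_on_eq_iff)
      then show ?thesis using 2 by auto
    qed (use e in auto)
  qed
  moreover have "Inr (j, i) \<in> E" if "i < length (\<tau> j)" for i
    using that assms by (auto simp: infl_set_def)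
  then have "(\<lambda>i. Inr (j, i)) ` {..<length (\<tau> j)} \<subseteq> cell_part E px py (cell \<rho> j)"
    using cell_of_inflation[OF assms] by (auto simp: cell_part_def core_inflation)
  ultimately have part: "cell_part E px py (cell \<rho> j) = (\<lambda>i. Inr (j, i)) ` {..<length (\<tau> j)}" by blast
  have "word (cell_part E px py (cell \<rho> j)) px py = word {..<length (\<tau> j)} (\<lambda>i. i) (nth (\<tau> j))"
    unfolding part
    by (rule word_iso[OF iso_Inr[OF assms]])
      (use inj_x cell_part_subset[of E px py "cell \<rho> j"] in \<open>auto simp: part intro: inj_on_subset\<close>)
  then show ?thesis by (simp add: word_perm[OF perms[OF assms]])
qed

text \<open>Together with \<open>cell_words_inflate\<close>, this says that an inflation determines
  its kernel and its cell contents, hence that no permutation is obtained twice.\<close>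

lemma kernel_shape_inflate: "kernel_shape (inflate \<rho> \<tau>) = \<rho>"
  using kernel_shape_word[OF finite_E inj_x inj_y] by (simp add: inflate_def word_core_inflation)

lemma cell_words_inflate: "cell_words (inflate \<rho> \<tau>) = restrict \<tau> J"
proof -
  have "cell_words (inflate \<rho> \<tau>) = (\<lambda>j\<in>J. word (cell_part E px py (cell \<rho> j)) px py)"
    using cell_words_word[OF finite_E inj_x inj_y] unfolding inflate_def word_core_inflation .
  also have "\<dots> = restrict \<tau> J"
    by (rule restrict_ext) (rule word_cell_part_inflation)
  finally show ?thesis .
qed

end

section \<open>Recovering a point set from its kernel and its cells\<close>

lemma rank_neq_between:
  assumes "x a < x b" "rank x S a \<noteq> rank x S b"
  shows "\<exists>s\<in>S. x a \<le> x s \<and> x s < x b"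
proof (rule ccontr)
  assume "\<not> ?thesis"
  then have "{s \<in> S. x s < x a} = {s \<in> S. x s < x b}" using assms(1) by force
  then show False using assms(2) by (simp add: rank_def)
qed

locale configuration =
  fixes E :: "'e set" and x :: "'e \<Rightarrow> 'a::linorder" and y :: "'e \<Rightarrow> 'b::linorder"
  assumes fin: "finite E" and inj_x: "inj_on x E" and inj_y: "inj_on y E" and nonempty: "E \<noteq> {}"
begin

abbreviation "\<kappa> \<equiv> core E x y"
abbreviation "\<rho> \<equiv> word \<kappa> x y"

lemma fin_core [simp]: "finite \<kappa>"
  by (rule finite_subset[OF core_subset fin])

lemma inj_x_core: "inj_on x \<kappa>"
  by (rule inj_on_subset[OF inj_x core_subset])

lemma core_in_E: "k \<in> \<kappa> \<Longrightarrow> k \<in> E"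
  by (rule subsetD[OF core_subset])

lemma kernel_perm: "kernel_perm \<rho>"
  by (rule kernel_perm_word_core[OF fin inj_x inj_y nonempty])

lemma occ_core: "(a, b, c) \<in> occs E x y \<Longrightarrow> a \<in> \<kappa> \<or> b \<in> \<kappa> \<or> c \<in> \<kappa> \<Longrightarrow> a \<in> \<kappa> \<and> b \<in> \<kappa> \<and> c \<in> \<kappa>"
  by (rule closed132_occ[OF closed132_core])

lemma x_less_or: "a \<in> E \<Longrightarrow> b \<in> E \<Longrightarrow> a \<noteq> b \<Longrightarrow> x a < x b \<or> x b < x a"
  using inj_on_eq_iff[OF inj_x, of a b] by (simp add: neq_iff)

lemma y_less_or: "a \<in> E \<Longrightarrow> b \<in> E \<Longrightarrow> a \<noteq> b \<Longrightarrow> y a < y b \<or> y b < y a"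
  using inj_on_eq_iff[OF inj_y, of a b] by (simp add: neq_iff)

lemma nth_core: "k \<in> \<kappa> \<Longrightarrow> \<rho> ! rank x \<kappa> k = Suc (rank y \<kappa> k)"
  by (rule nth_word[OF fin_core inj_x_core])

lemma x_core_less: "k \<in> \<kappa> \<Longrightarrow> x k < x e \<longleftrightarrow> rank x \<kappa> k < rank x \<kappa> e"
  by (rule rank_less_iff[OF fin_core, symmetric])

lemma y_core_less: "k \<in> \<kappa> \<Longrightarrow> y k < y e \<longleftrightarrow> \<rho> ! rank x \<kappa> k < Suc (rank y \<kappa> e)"
  by (simp add: rank_less_iff nth_core)

lemma y_core_less_core: "k \<in> \<kappa> \<Longrightarrow> k' \<in> \<kappa> \<Longrightarrow> y k < y k' \<longleftrightarrow> \<rho> ! rank x \<kappa> k < \<rho> ! rank x \<kappa> k'"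
  by (simp add: rank_less_iff nth_core)

lemma core_position:
  assumes "i < card \<kappa>"
  obtains k where "k \<in> \<kappa>" "rank x \<kappa> k = i"
proof -
  have "i \<in> rank x \<kappa> ` \<kappa>"
    using rank_bij[OF fin_core inj_x_core] assms by (simp add: bij_betw_def)
  then show thesis using that by auto
qed

text \<open>If the cell of \<open>e\<close> were infeasible, \<open>e\<close> would form an
  occurrence with two core points and thus belong to the core. The three cases are again the roles
  of \<open>e\<close> as 1, 3 or 2.\<close>

lemma cell_of_feasible:
  assumes e: "e \<in> E" "e \<notin> \<kappa>"
  shows "cell_of E x y e \<in> feasible_cells \<rho>"
proof -
  let ?l = "rank x \<kappa> e" and ?m = "rank y \<kappa> e"
  have l: "?l \<le> card \<kappa>" unfolding rank_def by (rule card_mono) auto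
  \<comment> \<open>The topmost point is in the core and not below \<open>e\<close>, so
    \<open>e\<close> avoids the region above all core points, where there is no cell.\<close>
  have m: "?m < card \<kappa>"
  proof -
    have "Max (y ` E) \<in> y ` E" using fin nonempty by (intro Max_in) auto
    then obtain t where t: "t \<in> E" "y t = Max (y ` E)" by (auto elim!: imageE)
    then have "t \<in> \<kappa>" by (intro closed132_top[OF closed132_core]) (auto simp: fin)
    moreover have "\<not> y t < y e" using t e fin by (simp add: not_less)
    ultimately show ?thesis unfolding rank_def by (intro psubset_card_mono) auto
  qed
  have "\<not> infeasible \<rho> (Suc ?m, Suc ?l)"
  proof
    assume "infeasible \<rho> (Suc ?m, Suc ?l)"
    then consider
        (one) i j where "?l \<le> i" "i < j" "j < card \<kappa>" "Suc ?m \<le> \<rho> ! j" "\<rho> ! j < \<rho> ! i"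
      | (three) i k where "i < ?l" "?l \<le> k" "k < card \<kappa>" "\<rho> ! i < \<rho> ! k" "\<rho> ! k < Suc ?m"
      | (two) i j where "i < j" "j < ?l" "\<rho> ! i < Suc ?m" "Suc ?m \<le> \<rho> ! j"
      using infeasible_iff[of "Suc ?l" \<rho> "Suc ?m"] l by auto
    then show False
    proof cases
      case one
      obtain a where a: "a \<in> \<kappa>" "rank x \<kappa> a = i" using core_position[of i] one by auto
      obtain b where b: "b \<in> \<kappa>" "rank x \<kappa> b = j" using core_position[of j] one by auto
      have "\<not> x a < x e" "x a < x b" "\<not> y b < y e" "y b < y a"
        using one a b x_core_less[OF a(1)] x_core_less[OF b(1)] y_core_less[OF a(1)] y_core_less[OF b(1)]
          y_core_less_core[OF a(1) b(1)] y_core_less_core[OF b(1) a(1)]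
        by simp_all
      moreover have "x a \<noteq> x e" "y b \<noteq> y e"
        using inj_x inj_y a b e core_in_E by (metis inj_onD)+
      ultimately have "(e, a, b) \<in> occs E x y"
        using a b e core_in_E by (auto simp: occs_def)
      then show False using occ_core a(1) e(2) by blast
    next
      case three
      obtain a where a: "a \<in> \<kappa>" "rank x \<kappa> a = i" using core_position[of i] three by auto
      obtain b where b: "b \<in> \<kappa>" "rank x \<kappa> b = k" using core_position[of k] three by auto
      have "x a < x e" "\<not> x b < x e" "y b < y e" "y a < y b"
        using three a b x_core_less[OF a(1)] x_core_less[OF b(1)] y_core_less[OF a(1)] y_core_less[OF b(1)]
          y_core_less_core[OF a(1) b(1)] y_core_less_core[OF b(1) a(1)]
        by simp_all
      moreover have "x b \<noteq> x e"
        using inj_x inj_y a b e core_in_E by (metis inj_onD)+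
      ultimately have "(a, e, b) \<in> occs E x y"
        using a b e core_in_E by (auto simp: occs_def)
      then show False using occ_core a(1) e(2) by blast
    next
      case two
      obtain a where a: "a \<in> \<kappa>" "rank x \<kappa> a = i" using core_position[of i] two l by auto
      obtain b where b: "b \<in> \<kappa>" "rank x \<kappa> b = j" using core_position[of j] two l by auto
      have "x a < x b" "x b < x e" "y a < y e" "\<not> y b < y e"
        using two a b x_core_less[OF a(1)] x_core_less[OF b(1)] y_core_less[OF a(1)] y_core_less[OF b(1)]
          y_core_less_core[OF a(1) b(1)] y_core_less_core[OF b(1) a(1)]
        by simp_all
      moreover have "y b \<noteq> y e"
        using inj_x inj_y a b e core_in_E by (metis inj_onD)+
      ultimately have "(a, b, e) \<in> occs E x y"
        using a b e core_in_E by (auto simp: occs_def)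
      then show False using occ_core a(1) e(2) by blast
    qed
  qed
  then show ?thesis using l m by (simp add: feasible_cells_def cell_of_def)
qed

lemma core_not_south_west:
  assumes e: "e \<in> E" "e \<notin> \<kappa>" and k: "k \<in> \<kappa>" "x k < x e"
  shows "y e < y k"
proof -
  have "rank x \<kappa> k < rank x \<kappa> e" using k by (simp add: x_core_less)
  then have "Suc (rank y \<kappa> e) \<le> \<rho> ! rank x \<kappa> k"
    using feasible_south_west_empty[OF kernel_perm cell_of_feasible[OF e, unfolded cell_of_def]] by simp
  then have "\<not> y k < y e" using y_core_less[OF k(1)] by simp
  then show ?thesis using y_less_or[of k e] e k core_in_E by blast
qed

text \<open>A kernel entry separating two increasing entries of different cells would form a 132 with
  them, because it cannot lie to the lower left of the second one.\<close>

lemma distinct_cells_decreasing: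
  assumes e: "e \<in> E" "e \<notin> \<kappa>" "e' \<in> E" "e' \<notin> \<kappa>"
    and ne: "cell_of E x y e \<noteq> cell_of E x y e'" and less: "x e < x e'"
  shows "y e' < y e"
proof (rule ccontr)
  assume "\<not> y e' < y e"
  then have y: "y e < y e'" using y_less_or[OF e(1,3)] less by blast
  show False
  proof (cases "rank x \<kappa> e = rank x \<kappa> e'")
    case False
    then obtain k where k: "k \<in> \<kappa>" "x e \<le> x k" "x k < x e'"
      using rank_neq_between[of x, OF less] by blast
    have "x e \<noteq> x k" using k e core_in_E inj_x by (metis inj_onD)
    moreover have "y e' < y k" using core_not_south_west e k by blast
    ultimately have "(e, k, e') \<in> occs E x y" using k e y core_in_E by (auto simp: occs_def)
    then show False using occ_core k(1) e by blast
  next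
    case True
    then have "rank y \<kappa> e \<noteq> rank y \<kappa> e'" using ne by (simp add: cell_of_def)
    then obtain k where k: "k \<in> \<kappa>" "y e \<le> y k" "y k < y e'"
      using rank_neq_between[of y, OF y] by blast
    have "y e \<noteq> y k" using k e core_in_E inj_y by (metis inj_onD)
    moreover have "x e' < x k"
      using core_not_south_west[OF e(3,4) k(1)] k(3) x_less_or[of k e'] k(1) e core_in_E by force
    ultimately have "(e, e', k) \<in> occs E x y" using k e less core_in_E by (auto simp: occs_def)
    then show False using occ_core k(1) e by blast
  qed
qed

abbreviation "part j \<equiv> cell_part E x y (cell \<rho> j)"
abbreviation "J \<equiv> {1..num_cells \<rho>}"

definition cell_index :: "'e \<Rightarrow> nat" where
  "cell_index e = inv_into J (cell \<rho>) (cell_of E x y e)"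

definition to_infl :: "'e \<Rightarrow> point" where
  "to_infl e = (if e \<in> \<kappa> then Inl (rank x \<kappa> e) else Inr (cell_index e, rank x (part (cell_index e)) e))"

lemma cell_index:
  assumes "e \<in> E" "e \<notin> \<kappa>"
  shows "cell_index e \<in> J" "cell \<rho> (cell_index e) = cell_of E x y e" "e \<in> part (cell_index e)"
proof -
  have "cell_of E x y e \<in> cell \<rho> ` J"
    using cell_of_feasible[OF assms] cell_bij[OF kernel_perm] by (simp add: bij_betw_def)
  then show "cell_index e \<in> J" "cell \<rho> (cell_index e) = cell_of E x y e"
    by (auto simp: cell_index_def inv_into_into f_inv_into_f simp del: atLeastAtMost_iff)
  then show "e \<in> part (cell_index e)" using assms by (simp add: cell_part_def)
qed

text \<open>The cells compare weakly as the points do: \<open>e'\<close> has no smaller column and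
  no larger row than \<open>e\<close>. If the index of \<open>e'\<close> came first, the chain would
  demand the opposite, and both cells would coincide.\<close>

lemma cell_index_mono:
  assumes e: "e \<in> E" "e \<notin> \<kappa>" "e' \<in> E" "e' \<notin> \<kappa>"
    and ne: "cell_index e \<noteq> cell_index e'" and less: "x e < x e'"
  shows "cell_index e < cell_index e'" "y e' < y e"
proof -
  have "cell_of E x y e \<noteq> cell_of E x y e'" using ne by (auto simp: cell_index_def)
  from distinct_cells_decreasing[OF e this less] show y: "y e' < y e" .
  show "cell_index e < cell_index e'"
  proof (rule ccontr)
    assume "\<not> ?thesis"
    then have "cell_prec (cell_of E x y e') (cell_of E x y e)"
      using cell_mono[OF kernel_perm, of "cell_index e'" "cell_index e"] ne cell_index[OF e(1,2)] cell_index[OF e(3,4)]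
      by simp
    moreover have "rank x \<kappa> e \<le> rank x \<kappa> e'" "rank y \<kappa> e' \<le> rank y \<kappa> e"
      using less y by (auto intro: rank_mono)
    ultimately show False by (auto simp: cell_prec_def cell_of_def)
  qed
qed

definition words :: "nat \<Rightarrow> nat list" where
  "words = (\<lambda>j\<in>J. word (part j) x y)"

lemma fin_part: "finite (part j)" and inj_x_part: "inj_on x (part j)" and inj_y_part: "inj_on y (part j)"
  using cell_part_subset[of E x y "cell \<rho> j"] fin inj_x inj_y
  by (auto intro: finite_subset inj_on_subset)

sublocale infl: inflation \<rho> words
  by unfold_locales
    (auto simp: kernel_perm words_def is_perm_word[OF fin_part inj_x_part inj_y_part])

lemma nth_words:
  assumes "e \<in> E" "e \<notin> \<kappa>"
  shows "words (cell_index e) ! rank x (part (cell_index e)) e = Suc (rank y (part (cell_index e)) e)"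
  using cell_index(1)[OF assms] nth_word[OF fin_part inj_x_part cell_index(3)[OF assms]]
  by (simp add: words_def)

lemma to_infl_x_mono:
  assumes "e \<in> E" "e' \<in> E" "x e < x e'"
  shows "infl_x \<rho> (to_infl e) < infl_x \<rho> (to_infl e')"
proof (cases "e \<in> \<kappa>")
  case k: True
  then have "rank x \<kappa> e < rank x \<kappa> e'" using k assms(3) by (simp add: rank_less_iff)
  then show ?thesis
    using k assms cell_index[of e'] by (auto simp: to_infl_def infl_order cell_of_def)
next
  case e: False
  show ?thesis
  proof (cases "e' \<in> \<kappa>")
    case True
    have "rank x \<kappa> e \<le> rank x \<kappa> e'" using assms(3) by (intro rank_mono) auto
    then show ?thesis
      using True e assms cell_index[of e] by (auto simp: to_infl_def infl_order cell_of_def)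
  next
    case e': False
    show ?thesis
    proof (cases "cell_index e = cell_index e'")
      case True
      then have "rank x (part (cell_index e)) e < rank x (part (cell_index e)) e'"
        using rank_less[OF fin_part cell_index(3)[OF assms(1) e] assms(3)] by simp
      then show ?thesis
        using True e e' cell_index[OF assms(1) e] by (simp add: to_infl_def infl_order kernel_perm)
    next
      case False
      then show ?thesis
        using e e' cell_index[OF assms(1) e] cell_index[OF assms(2) e']
          cell_index_mono(1)[OF assms(1) e assms(2) e' False assms(3)]
        by (simp add: to_infl_def infl_order kernel_perm)
    qed
  qed
qed

lemma to_infl_y_mono:
  assumes "e \<in> E" "e' \<in> E" "y e < y e'"
  shows "infl_y \<rho> words (to_infl e) < infl_y \<rho> words (to_infl e')"
proof (cases "e \<in> \<kappa>")
  case k: True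
  then have "rank y \<kappa> e < rank y \<kappa> e'" using k assms(3) by (simp add: rank_less_iff)
  then show ?thesis
    using k assms cell_index[of e'] by (auto simp: to_infl_def infl_order cell_of_def nth_core)
next
  case e: False
  show ?thesis
  proof (cases "e' \<in> \<kappa>")
    case True
    have "rank y \<kappa> e \<le> rank y \<kappa> e'" using assms(3) by (intro rank_mono) auto
    then show ?thesis
      using True e assms cell_index[of e] by (auto simp: to_infl_def infl_order cell_of_def nth_core)
  next
    case e': False
    show ?thesis
    proof (cases "cell_index e = cell_index e'")
      case True
      then have "rank y (part (cell_index e)) e < rank y (part (cell_index e)) e'"
        using rank_less[OF fin_part cell_index(3)[OF assms(1) e] assms(3)] by simp
      then show ?thesis
        using True e e' cell_index[OF assms(1) e] nth_words[OF assms(1) e] nth_words[OF assms(2) e']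
        by (simp add: to_infl_def infl_order kernel_perm)
    next
      case False
      \<comment> \<open>Different cells descend, so the higher point \<open>e'\<close> is the left
        one; this matches the reversed second coordinate of \<open>infl_y\<close>.\<close>
      have "\<not> x e < x e'" using cell_index_mono(2)[OF assms(1) e assms(2) e' False] assms(3) by force
      then have "x e' < x e" using x_less_or[OF assms(1,2)] assms(3) by blast
      from cell_index_mono(1)[OF assms(2) e' assms(1) e False[symmetric] this] show ?thesis
        using e e' cell_index[OF assms(1) e] cell_index[OF assms(2) e']
        by (simp add: to_infl_def infl_order kernel_perm)
    qed
  qed
qed

text \<open>Monotonicity in both coordinates nearly suffices: any two different points of
  \<open>E\<close> are comparable, so it also yields injectivity and the reverse implications.
  Surjectivity holds because ranks fill initial segments of the numbers.\<close>

lemma to_infl_iso: "order_iso to_infl E x y (infl_set \<rho> words) (infl_x \<rho>) (infl_y \<rho> words)"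
  unfolding order_iso_def bij_betw_def
proof (intro conjI ballI iffI)
  show "inj_on to_infl E"
  proof (rule inj_onI)
    fix e e' assume e: "e \<in> E" "e' \<in> E" "to_infl e = to_infl e'"
    have "\<not> x e < x e'" "\<not> x e' < x e"
      using to_infl_x_mono[OF e(1,2)] to_infl_x_mono[OF e(2,1)] e(3) by auto
    then show "e = e'" using x_less_or e by blast
  qed
  show "to_infl ` E = infl_set \<rho> words"
  proof (intro equalityI subsetI)
    fix p assume "p \<in> to_infl ` E"
    then obtain e where e: "e \<in> E" "p = to_infl e" by auto
    show "p \<in> infl_set \<rho> words"
    proof (cases "e \<in> \<kappa>")
      case True
      then show ?thesis using e rank_less_card[OF fin_core True, of x] by (auto simp: to_infl_def infl_set_def)
    next
      case False
      note c = cell_index[OF e(1) False]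
      have "rank x (part (cell_index e)) e < card (part (cell_index e))"
        by (rule rank_less_card[OF fin_part c(3)])
      then show ?thesis using e False c(1) by (auto simp: to_infl_def infl_set_def words_def)
    qed
  next
    fix p assume "p \<in> infl_set \<rho> words"
    then show "p \<in> to_infl ` E"
    proof (cases rule: infl.E_cases)
      case (1 i)
      then obtain k where "k \<in> \<kappa>" "rank x \<kappa> k = i" using core_position[of i] by auto
      then have "p = to_infl k" "k \<in> E" using 1 core_in_E by (auto simp: to_infl_def)
      then show ?thesis by blast
    next
      case (2 j i)
      then have "i \<in> rank x (part j) ` part j"
        using rank_bij[OF fin_part inj_x_part, of j] by (simp add: bij_betw_def words_def)
      then obtain e where e: "e \<in> part j" "i = rank x (part j) e" by auto
      then have eE: "e \<in> E" "e \<notin> \<kappa>" and "cell_of E x y e = cell \<rho> j" by (auto simp: cell_part_def)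
      then have "cell_index e = j"
        using cell_bij[OF kernel_perm] 2(2) by (simp add: cell_index_def bij_betw_def inv_into_f_f)
      then have "p = to_infl e" using 2 e eE by (simp add: to_infl_def)
      then show ?thesis using eE by blast
    qed
  qed
next
  fix e e' assume e: "e \<in> E" "e' \<in> E"
  show "infl_x \<rho> (to_infl e) < infl_x \<rho> (to_infl e')" if "x e < x e'" using to_infl_x_mono[OF e that] .
  show "infl_y \<rho> words (to_infl e) < infl_y \<rho> words (to_infl e')" if "y e < y e'" using to_infl_y_mono[OF e that] .
  show "x e < x e'" if "infl_x \<rho> (to_infl e) < infl_x \<rho> (to_infl e')"
    using to_infl_x_mono[OF e(2,1)] x_less_or[OF e] that by fastforce
  show "y e < y e'" if "infl_y \<rho> words (to_infl e) < infl_y \<rho> words (to_infl e')"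
    using to_infl_y_mono[OF e(2,1)] y_less_or[OF e] that by fastforce
qed

lemma inflate_words: "inflate \<rho> words = word E x y"
  unfolding inflate_def by (rule word_iso[OF to_infl_iso fin inj_x infl.inj_x])

end

lemma decomposition:
  assumes "is_perm \<pi>" "\<pi> \<noteq> []"
  shows "inflation (kernel_shape \<pi>) (cell_words \<pi>)" "inflate (kernel_shape \<pi>) (cell_words \<pi>) = \<pi>"
proof -
  interpret configuration "{..<length \<pi>}" "\<lambda>i. i" "nth \<pi>"
    using assms is_perm_inj by unfold_locales auto
  have "kernel_shape \<pi> = \<rho>" by (rule kernel_shape_eq[OF assms(1)])
  moreover from this have "cell_words \<pi> = words" by (simp add: cell_words_def words_def)
  ultimately show "inflation (kernel_shape \<pi>) (cell_words \<pi>)" "inflate (kernel_shape \<pi>) (cell_words \<pi>) = \<pi>"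
    using infl.inflation_axioms inflate_words word_perm[OF assms(1)] by auto
qed

text \<open>A kernel is no longer than its permutation. Conversely, a short kernel permutation is
  padded to length \<open>t\<close> by filling one of its cells, which does not change the
  kernel.\<close>

lemma K_eq:
  assumes "t > 0"
  shows "K t = {\<rho>. kernel_perm \<rho> \<and> length \<rho> \<le> t}"
proof (intro equalityI subsetI)
  fix \<rho> assume "\<rho> \<in> K t"
  then obtain \<pi> where \<pi>: "\<pi> \<in> permutations_of_set {1..t}" "\<rho> = kernel_shape \<pi>" by (auto simp: K_def)
  then have len: "length \<pi> = t" using length_finite_permutations_of_set by fastforce
  then have is_perm: "is_perm \<pi>" and "\<pi> \<noteq> []" using \<pi> assms by (auto simp: is_perm_def)
  then interpret inflation \<rho> "cell_words \<pi>" using decomposition \<pi> by simp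
  have "length \<rho> \<le> length (inflate \<rho> (cell_words \<pi>))" by (simp add: length_inflate)
  then show "\<rho> \<in> {\<rho>. kernel_perm \<rho> \<and> length \<rho> \<le> t}"
    using kernel_perm len decomposition(2)[OF is_perm \<open>\<pi> \<noteq> []\<close>] \<pi> by simp
next
  fix \<rho> assume "\<rho> \<in> {\<rho>. kernel_perm \<rho> \<and> length \<rho> \<le> t}"
  then have \<rho>: "kernel_perm \<rho>" "length \<rho> \<le> t" by auto
  have "(1, length \<rho> + 1) \<in> cell \<rho> ` {1..num_cells \<rho>}"
    using bottom_right_feasible[of \<rho>] cell_bij[OF \<rho>(1)] \<rho>(1) by (simp add: kernel_perm_def bij_betw_def)
  then obtain j0 where j0: "j0 \<in> {1..num_cells \<rho>}" by blast
  \<comment> \<open>An increasing word supplies exactly the \<open>t - length \<rho>\<close> missing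
    letters.\<close>
  define \<tau> where "\<tau> j = (if j = j0 then [1..<t - length \<rho> + 1] else [])" for j
  interpret inflation \<rho> \<tau>
    by unfold_locales (auto simp: \<rho> \<tau>_def is_perm_iff)
  have "(\<Sum>j\<in>J. length (\<tau> j)) = (\<Sum>j\<in>J. if j = j0 then t - length \<rho> else 0)"
    by (intro sum.cong) (auto simp: \<tau>_def)
  also have "\<dots> = t - length \<rho>" using j0 by simp
  finally have "length (inflate \<rho> \<tau>) = t" using \<rho>(2) by (simp add: length_inflate)
  then have "inflate \<rho> \<tau> \<in> permutations_of_set {1..t}" using is_perm_inflate by (simp add: is_perm_def)
  then show "\<rho> \<in> K t" unfolding K_def using kernel_shape_inflate by (metis imageI)
qed

section \<open>Generating functions\<close>

unbundle fps_syntax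

text \<open>The series are infinite, but the coefficient at \<open>n\<close> sees only words of
  length at most \<open>n\<close>. Truncation makes all index sets finite, so that products of sums
  can be expanded.\<close>

definition perms_upto :: "nat \<Rightarrow> nat list set" where
  "perms_upto n = {\<tau>. is_perm \<tau> \<and> length \<tau> \<le> n}"

lemma finite_perms_upto [simp]: "finite (perms_upto n)"
proof -
  have "perms_upto n = (\<Union>k\<le>n. {\<tau> \<in> permutations_of_set {1..k}. length \<tau> = k})"
    by (auto simp: perms_upto_def is_perm_def)
  then show ?thesis by simp
qed

lemma permutations_of_set_eq: "permutations_of_set {1..n} = {\<tau>. is_perm \<tau> \<and> length \<tau> = n}"
  using length_finite_permutations_of_set[of _ "{1..n}"] by (auto simp: is_perm_def)

lemma M_nth: "M q $ n = (\<Sum>\<tau> | is_perm \<tau> \<and> length \<tau> = n \<and> num132 \<tau> = q. of_int (perm_sign \<tau>))"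
  unfolding M_def permutations_of_set_eq by (simp add: conj_assoc)

lemma fps_neg_arg_nth: "fps_neg_arg A $ n = (- 1) ^ n * A $ n"
proof -
  have "- fps_X = fps_const (- 1) * (fps_X :: rat fps)" by (simp flip: fps_const_neg)
  then show ?thesis by (simp only: fps_neg_arg_def fps_nth_compose_linear)
qed

section \<open>Parity parts of the series and their products\<close>

definition parity_perms :: "nat \<Rightarrow> nat \<Rightarrow> nat \<Rightarrow> nat list set" where
  "parity_perms n q v = {\<tau> \<in> perms_upto n. num132 \<tau> = q \<and> even (v + length \<tau>)}"

lemma finite_parity_perms [simp]: "finite (parity_perms n q v)"
  by (simp add: parity_perms_def)

text \<open>The coefficient of \<open>M q\<close> is multiplied by
  \<open>1 + (- 1) ^ (v + k)\<close>, which is 2 if \<open>k\<close> has the parity of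
  \<open>v\<close> and 0 otherwise. The right-hand side is a polynomial that agrees with the series
  through degree \<open>n\<close>.\<close>

lemma parity_part_nth:
  assumes "k \<le> n"
  shows "(M q + (- 1) ^ v * fps_neg_arg (M q)) $ k =
    (\<Sum>\<tau>\<in>parity_perms n q v. fps_const (2 * of_int (perm_sign \<tau>)) * fps_X ^ length \<tau>) $ k"
proof -
  have "((- 1) ^ v :: rat fps) = fps_const ((- 1) ^ v)"
    by (simp flip: fps_const_power fps_const_neg)
  then have "(M q + (- 1) ^ v * fps_neg_arg (M q)) $ k = (1 + (- 1) ^ (v + k)) * M q $ k"
    by (simp add: fps_neg_arg_nth power_add algebra_simps)
  also have "\<dots> = (\<Sum>\<tau> | is_perm \<tau> \<and> length \<tau> = k \<and> num132 \<tau> = q.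
      (if even (v + length \<tau>) then 2 * of_int (perm_sign \<tau>) else 0))"
    unfolding M_nth sum_distrib_left by (intro sum.cong) (auto simp: minus_one_power_iff)
  also have "\<dots> = (\<Sum>\<tau>\<in>parity_perms n q v. if length \<tau> = k then 2 * of_int (perm_sign \<tau>) else 0)"
  proof -
    have "(\<Sum>\<tau> | is_perm \<tau> \<and> length \<tau> = k \<and> num132 \<tau> = q.
        (if even (v + length \<tau>) then 2 * of_int (perm_sign \<tau>) else 0)) =
      (\<Sum>\<tau>\<in>{\<tau> \<in> parity_perms n q v. length \<tau> = k}. 2 * rat_of_int (perm_sign \<tau>))"
    proof (rule sum.mono_neutral_cong_right)
      show "finite {\<tau>. is_perm \<tau> \<and> length \<tau> = k \<and> num132 \<tau> = q}"
        by (rule finite_subset[OF _ finite_perms_upto[of k]]) (auto simp: perms_upto_def)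
    qed (use assms in \<open>auto simp: parity_perms_def perms_upto_def\<close>)
    then show ?thesis by (simp add: sum.inter_filter)
  qed
  also have "\<dots> = (\<Sum>\<tau>\<in>parity_perms n q v. fps_const (2 * of_int (perm_sign \<tau>)) * fps_X ^ length \<tau>) $ k"
    by (simp add: fps_sum_nth fps_X_power_nth if_distrib cong: if_cong)
      (intro sum.cong, auto)
  finally show ?thesis .
qed

text \<open>Allows each factor to be replaced by a truncation: in the convolution for degree
  \<open>k \<le> n\<close>, no factor is used above degree \<open>n\<close>.\<close>

lemma fps_prod_nth_cong:
  fixes f g :: "'i \<Rightarrow> 'a::comm_ring_1 fps"
  assumes "\<And>j k. j \<in> J \<Longrightarrow> k \<le> n \<Longrightarrow> f j $ k = g j $ k" "k \<le> n"
  shows "prod f J $ k = prod g J $ k"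
  using assms
proof (induction J arbitrary: k rule: infinite_finite_induct)
  case (insert j J)
  then show ?case by (auto simp: fps_mult_nth intro!: sum.cong)
qed auto

lemma prod_monomials:
  "(\<Prod>j\<in>J. fps_const (c j) * fps_X ^ d j) = fps_const (\<Prod>j\<in>J. c j) * (fps_X :: 'a::comm_ring_1 fps) ^ (\<Sum>j\<in>J. d j)"
  by (induction J rule: infinite_finite_induct) (simp_all add: power_add ac_simps flip: fps_const_mult)

text \<open>Expanding the product chooses one permutation for every index; each factor contributes a
  2, to be cancelled by the 2^(-f) of the formula.\<close>

lemma prod_parity_parts_nth:
  fixes J :: "nat set"
  assumes "finite J" "k \<le> n"
  shows "(\<Prod>j\<in>J. M (rs j) + (- 1) ^ v j * fps_neg_arg (M (rs j))) $ k =
    2 ^ card J * (\<Sum>g | g \<in> (\<Pi>\<^sub>E j\<in>J. parity_perms n (rs j) (v j)) \<and> (\<Sum>j\<in>J. length (g j)) = k.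
      \<Prod>j\<in>J. of_int (perm_sign (g j)))"
proof -
  let ?G = "\<Pi>\<^sub>E j\<in>J. parity_perms n (rs j) (v j)"
  have fin: "finite ?G" using assms(1) by (intro finite_PiE) auto
  have "(\<Prod>j\<in>J. M (rs j) + (- 1) ^ v j * fps_neg_arg (M (rs j))) $ k =
      (\<Prod>j\<in>J. \<Sum>\<tau>\<in>parity_perms n (rs j) (v j). fps_const (2 * of_int (perm_sign \<tau>)) * fps_X ^ length \<tau>) $ k"
    by (rule fps_prod_nth_cong[of _ n]) (use assms(2) in \<open>simp_all only: parity_part_nth\<close>)
  also have "\<dots> = (\<Sum>g\<in>?G. fps_const (\<Prod>j\<in>J. 2 * of_int (perm_sign (g j))) * fps_X ^ (\<Sum>j\<in>J. length (g j))) $ k"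
    using assms(1) by (simp only: prod_sum_PiE finite_parity_perms prod_monomials)
  also have "\<dots> = (\<Sum>g\<in>?G. if (\<Sum>j\<in>J. length (g j)) = k then 2 ^ card J * (\<Prod>j\<in>J. of_int (perm_sign (g j))) else 0)"
    by (auto simp: fps_sum_nth fps_X_power_nth prod.distrib intro!: sum.cong)
  also have "\<dots> = (\<Sum>g | g \<in> ?G \<and> (\<Sum>j\<in>J. length (g j)) = k. 2 ^ card J * (\<Prod>j\<in>J. of_int (perm_sign (g j))))"
    by (rule sum.inter_filter[OF fin, symmetric])
  finally show ?thesis by (simp add: sum_distrib_left)
qed

section \<open>Summation over kernels and fillings\<close>

definition fillings :: "nat list \<Rightarrow> nat \<Rightarrow> nat \<Rightarrow> (nat \<Rightarrow> nat list) set" where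
  "fillings \<rho> r n = {\<tau> \<in> {1..num_cells \<rho>} \<rightarrow>\<^sub>E perms_upto n.
     num132 \<rho> + (\<Sum>j = 1..num_cells \<rho>. num132 (\<tau> j)) = r \<and>
     length \<rho> + (\<Sum>j = 1..num_cells \<rho>. length (\<tau> j)) = n}"

lemma finite_fillings [simp]: "finite (fillings \<rho> r n)"
  unfolding fillings_def by (rule finite_subset[of _ "{1..num_cells \<rho>} \<rightarrow>\<^sub>E perms_upto n"])
    (auto intro: finite_PiE)

lemma inflation_filling: "kernel_perm \<rho> \<Longrightarrow> \<tau> \<in> fillings \<rho> r n \<Longrightarrow> inflation \<rho> \<tau>"
  by unfold_locales (auto simp: fillings_def perms_upto_def PiE_iff)

text \<open>\<open>inflate\<close> is a bijection from kernels with fillings onto the permutations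
  counted by the coefficient; its inverse is the pair of \<open>kernel_shape\<close> and
  \<open>cell_words\<close>. Length 0 is excluded because the empty permutation has no
  kernel.\<close>

lemma sum_over_kernels:
  assumes "n > 0"
  shows "(\<Sum>\<rho>\<in>K (2 * r + 1). \<Sum>\<tau>\<in>fillings \<rho> r n. rat_of_int (perm_sign (inflate \<rho> \<tau>))) = M r $ n"
proof -
  have "finite (K (2 * r + 1))" by (simp add: K_def)
  then have "(\<Sum>\<rho>\<in>K (2 * r + 1). \<Sum>\<tau>\<in>fillings \<rho> r n. rat_of_int (perm_sign (inflate \<rho> \<tau>))) =
      (\<Sum>(\<rho>, \<tau>) \<in> (SIGMA \<rho>:K (2 * r + 1). fillings \<rho> r n). rat_of_int (perm_sign (inflate \<rho> \<tau>)))"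
    by (intro sum.Sigma) auto
  also have "\<dots> = (\<Sum>\<pi> | is_perm \<pi> \<and> length \<pi> = n \<and> num132 \<pi> = r. rat_of_int (perm_sign \<pi>))"
  proof (rule sum.reindex_bij_witness[where i = "\<lambda>\<pi>. (kernel_shape \<pi>, cell_words \<pi>)" and j = "\<lambda>(\<rho>, \<tau>). inflate \<rho> \<tau>"])
    fix p assume "p \<in> (SIGMA \<rho>:K (2 * r + 1). fillings \<rho> r n)"
    then obtain \<rho> \<tau> where p: "p = (\<rho>, \<tau>)" "kernel_perm \<rho>" "\<tau> \<in> fillings \<rho> r n"
      by (auto simp: K_eq)
    interpret inflation \<rho> \<tau> by (rule inflation_filling[OF p(2,3)])
    have "restrict \<tau> J = \<tau>" using p(3) by (auto simp: fillings_def PiE_def extensional_restrict)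
    then show "(kernel_shape (case p of (\<rho>, \<tau>) \<Rightarrow> inflate \<rho> \<tau>), cell_words (case p of (\<rho>, \<tau>) \<Rightarrow> inflate \<rho> \<tau>)) = p"
      by (simp add: p(1) kernel_shape_inflate cell_words_inflate)
    show "(case p of (\<rho>, \<tau>) \<Rightarrow> inflate \<rho> \<tau>) \<in> {\<pi>. is_perm \<pi> \<and> length \<pi> = n \<and> num132 \<pi> = r}"
      using p(3) by (simp add: p(1) is_perm_inflate length_inflate num132_inflate fillings_def)
  next
    fix \<pi> assume "\<pi> \<in> {\<pi>. is_perm \<pi> \<and> length \<pi> = n \<and> num132 \<pi> = r}"
    then have \<pi>: "is_perm \<pi>" "\<pi> \<noteq> []" "length \<pi> = n" "num132 \<pi> = r" using assms by auto
    interpret inflation "kernel_shape \<pi>" "cell_words \<pi>" by (rule decomposition(1)[OF \<pi>(1,2)])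
    have eq: "inflate (kernel_shape \<pi>) (cell_words \<pi>) = \<pi>" by (rule decomposition(2)[OF \<pi>(1,2)])
    show "(case (kernel_shape \<pi>, cell_words \<pi>) of (\<rho>, \<tau>) \<Rightarrow> inflate \<rho> \<tau>) = \<pi>" by (simp add: eq)
    have len: "length (kernel_shape \<pi>) + (\<Sum>j\<in>J. length (cell_words \<pi> j)) = n"
      and num: "num132 (kernel_shape \<pi>) + (\<Sum>j\<in>J. num132 (cell_words \<pi> j)) = r"
      using length_inflate num132_inflate eq \<pi> by auto
    \<comment> \<open>The origin of the size \<open>2 * r + 1\<close>: the kernel carries at most
      \<open>r\<close> of the occurrences.\<close>
    have "length (kernel_shape \<pi>) \<le> 2 * r + 1"
      using kernel_perm_length[OF kernel_perm] num by linarith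
    then have "kernel_shape \<pi> \<in> K (2 * r + 1)" using kernel_perm by (simp add: K_eq)
    moreover have "length (cell_words \<pi> j) \<le> n" if "j \<in> J" for j
      using member_le_sum[of j J "\<lambda>j. length (cell_words \<pi> j)"] that len by simp
    then have "cell_words \<pi> \<in> J \<rightarrow>\<^sub>E perms_upto n"
      using perms by (auto simp: perms_upto_def PiE_iff cell_words_def)
    ultimately show "(kernel_shape \<pi>, cell_words \<pi>) \<in> (SIGMA \<rho>:K (2 * r + 1). fillings \<rho> r n)"
      using len num by (simp add: fillings_def)
  qed auto
  finally show ?thesis by (simp add: M_nth)
qed

text \<open>A filling determines \<open>rs\<close> and \<open>v\<close>, namely the occurrence
  numbers of its words and their lengths modulo 2, so the triple sum is a single sum over fillings.
  Membership of \<open>v\<close> in \<open>X\<close> becomes the condition that \<open>a + n\<close>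
  is even.\<close>

lemma sum_parities_fillings:
  assumes \<rho>: "kernel_perm \<rho>"
  defines "J \<equiv> {1..num_cells \<rho>}"
  shows "(\<Sum>rs \<in> weak_comps (num_cells \<rho>) r (num132 \<rho>). \<Sum>v \<in> X \<rho> ((- 1) ^ a).
      \<Sum>\<tau> | \<tau> \<in> (\<Pi>\<^sub>E j\<in>J. parity_perms n (rs j) (v j)) \<and> length \<rho> + (\<Sum>j\<in>J. length (\<tau> j)) = n.
        of_int (z \<rho> v) * (\<Prod>j\<in>J. of_int (perm_sign (\<tau> j)))) =
    (if even (a + n) then \<Sum>\<tau>\<in>fillings \<rho> r n. rat_of_int (perm_sign (inflate \<rho> \<tau>)) else 0)"
proof -
  let ?W = "weak_comps (num_cells \<rho>) r (num132 \<rho>)" and ?X = "X \<rho> ((- 1) ^ a)"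
  let ?G = "\<lambda>(rs, v). {\<tau>. \<tau> \<in> (\<Pi>\<^sub>E j\<in>J. parity_perms n (rs j) (v j)) \<and> length \<rho> + (\<Sum>j\<in>J. length (\<tau> j)) = n}"
  let ?t = "\<lambda>v \<tau>. rat_of_int (z \<rho> v) * (\<Prod>j\<in>J. of_int (perm_sign (\<tau> j)))"
  have finJ: "finite J" by (simp add: J_def)
  have finX: "finite ?X"
    unfolding X_def by (rule finite_subset[of _ "{1..num_cells \<rho>} \<rightarrow>\<^sub>E {0, 1}"]) (auto intro: finite_PiE)
  have finG: "finite (?G p)" for p
    by (rule finite_subset[of _ "\<Pi>\<^sub>E j\<in>J. parity_perms n (fst p j) (snd p j)"])
      (auto intro!: finite_PiE simp: finJ split: prod.splits)
  have "(\<Sum>rs\<in>?W. \<Sum>v\<in>?X. \<Sum>\<tau>\<in>?G (rs, v). ?t v \<tau>) = (\<Sum>p\<in>?W \<times> ?X. \<Sum>\<tau>\<in>?G p. ?t (snd p) \<tau>)"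
    by (simp add: sum.cartesian_product split_def)
  also have "\<dots> = (\<Sum>(p, \<tau>)\<in>(SIGMA p:?W \<times> ?X. ?G p). ?t (snd p) \<tau>)"
    using finX finG finite_weak_comps by (intro sum.Sigma) auto
  also have "\<dots> = (\<Sum>\<tau>\<in>{\<tau> \<in> fillings \<rho> r n. even (a + n)}. rat_of_int (perm_sign (inflate \<rho> \<tau>)))"
  proof (rule sum.reindex_bij_witness[where j = snd and
        i = "\<lambda>\<tau>. ((\<lambda>j\<in>J. num132 (\<tau> j), \<lambda>j\<in>J. length (\<tau> j) mod 2), \<tau>)"])
    fix q assume "q \<in> (SIGMA p:?W \<times> ?X. ?G p)"
    then obtain rs v \<tau> where q: "q = ((rs, v), \<tau>)" and rs: "rs \<in> ?W" and v: "v \<in> ?X"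
      and \<tau>: "\<tau> \<in> (\<Pi>\<^sub>E j\<in>J. parity_perms n (rs j) (v j))" and len: "length \<rho> + (\<Sum>j\<in>J. length (\<tau> j)) = n"
      by auto
    have num: "num132 (\<tau> j) = rs j" and par: "even (v j + length (\<tau> j))" and mem: "\<tau> j \<in> perms_upto n"
      if "j \<in> J" for j using that \<tau> by (auto simp: parity_perms_def)
    have rsE: "rs \<in> extensional J" and sumrs: "(\<Sum>j\<in>J. rs j) + num132 \<rho> = r"
      using rs by (auto simp: weak_comps_def J_def PiE_def)
    have vE: "v \<in> extensional J" and v01: "\<And>j. j \<in> J \<Longrightarrow> v j = 0 \<or> v j = 1"
      and sumv: "(- 1) ^ ((\<Sum>j\<in>J. v j) + length \<rho>) = ((- 1) ^ a :: int)"
      using v by (auto simp: X_def J_def PiE_def Pi_def)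
    \<comment> \<open>A value in \<open>{0, 1}\<close> is fixed by its parity, so \<open>v\<close>
      can be recovered from \<open>\<tau>\<close>.\<close>
    have vmod: "length (\<tau> j) mod 2 = v j" if "j \<in> J" for j
      using v01[OF that] par[OF that] by presburger
    show "((\<lambda>j\<in>J. num132 (snd q j), \<lambda>j\<in>J. length (snd q j) mod 2), snd q) = q"
      using num vmod rsE vE by (auto simp: q extensional_def)
    have sumlen: "(- 1) ^ (\<Sum>j\<in>J. v j) = ((- 1) ^ (\<Sum>j\<in>J. length (\<tau> j)) :: int)"
      unfolding power_sum using par by (intro prod.cong) (auto simp: minus_one_power_iff)
    have "(- 1) ^ a = ((- 1) ^ n :: int)"
      using sumv sumlen unfolding len[symmetric] by (simp add: power_add mult.commute)
    then have "even (a + n)" by (auto simp: minus_one_power_iff split: if_splits)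
    then show "snd q \<in> {\<tau> \<in> fillings \<rho> r n. even (a + n)}"
      using \<tau> mem len sumrs num by (auto simp: q fillings_def J_def PiE_iff add.commute)
    then interpret inflation \<rho> \<tau> using inflation_filling[OF \<rho>, of \<tau> r n] by (simp add: q)
    \<comment> \<open>Exponents of -1 matter only modulo 2, so \<open>v j\<close> may stand for
      \<open>length (\<tau> j)\<close>; this turns \<open>z\<close> into the sign factor of
      \<open>perm_sign_inflate\<close>.\<close>
    have pairs: "(- 1) ^ (\<Sum>j\<in>J. \<Sum>i=1..<j. v i * v j) =
        ((- 1) ^ (\<Sum>j\<in>J. \<Sum>i=1..<j. length (\<tau> i) * length (\<tau> j)) :: int)"
      unfolding power_sum
    proof (intro prod.cong refl)
      fix j i assume "j \<in> J" "i \<in> {1..<j}"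
      then have "i \<in> J" by (auto simp: J_def)
      then show "(- 1) ^ (v i * v j) = ((- 1) ^ (length (\<tau> i) * length (\<tau> j)) :: int)"
        using par[of i] par[of j] \<open>j \<in> J\<close> by (auto simp: minus_one_power_iff)
    qed
    have kern: "(- 1) ^ (\<Sum>j\<in>J. l_num \<rho> j * v j) = ((- 1) ^ (\<Sum>j\<in>J. l_num \<rho> j * length (\<tau> j)) :: int)"
      unfolding power_sum using par by (intro prod.cong) (auto simp: minus_one_power_iff)
    have "z \<rho> v * (\<Prod>j\<in>J. perm_sign (\<tau> j)) = perm_sign (inflate \<rho> \<tau>)"
      using pairs kern by (simp add: z_def perm_sign_inflate power_add J_def ac_simps)
    then show "rat_of_int (perm_sign (inflate \<rho> (snd q))) = (case q of (p, \<tau>) \<Rightarrow> ?t (snd p) \<tau>)"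
      by (simp add: q flip: of_int_prod of_int_mult)
  next
    fix \<tau> assume "\<tau> \<in> {\<tau> \<in> fillings \<rho> r n. even (a + n)}"
    then have \<tau>: "\<tau> \<in> J \<rightarrow>\<^sub>E perms_upto n" and num: "num132 \<rho> + (\<Sum>j\<in>J. num132 (\<tau> j)) = r"
      and len: "length \<rho> + (\<Sum>j\<in>J. length (\<tau> j)) = n" and par: "even (a + n)"
      by (auto simp: fillings_def J_def)
    show "snd ((\<lambda>j\<in>J. num132 (\<tau> j), \<lambda>j\<in>J. length (\<tau> j) mod 2), \<tau>) = \<tau>" by simp
    have "(\<lambda>j\<in>J. num132 (\<tau> j)) \<in> ?W" using num by (simp add: weak_comps_def J_def add.commute)
    moreover have "(\<lambda>j\<in>J. length (\<tau> j) mod 2) \<in> ?X"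
    proof -
      have "(- 1) ^ (\<Sum>j\<in>J. length (\<tau> j) mod 2) = ((- 1) ^ (\<Sum>j\<in>J. length (\<tau> j)) :: int)"
        unfolding power_sum by (intro prod.cong) (auto simp: minus_one_power_iff)
      then have "(- 1) ^ ((\<Sum>j\<in>J. length (\<tau> j) mod 2) + length \<rho>) = ((- 1) ^ n :: int)"
        unfolding len[symmetric] by (simp add: power_add mult.commute)
      also have "\<dots> = (- 1) ^ a" using par by (auto simp: minus_one_power_iff)
      finally show ?thesis by (auto simp: X_def J_def)
    qed
    moreover have "\<tau> \<in> ?G (\<lambda>j\<in>J. num132 (\<tau> j), \<lambda>j\<in>J. length (\<tau> j) mod 2)"
      using \<tau> len by (auto simp: parity_perms_def PiE_iff)
    ultimately show "((\<lambda>j\<in>J. num132 (\<tau> j), \<lambda>j\<in>J. length (\<tau> j) mod 2), \<tau>) \<in> (SIGMA p:?W \<times> ?X. ?G p)"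
      by blast
  qed
  finally show ?thesis by simp
qed

text \<open>Multiplication by \<open>fps_X ^ length \<rho>\<close> leaves degree
  \<open>n - length \<rho>\<close> to the letters in the cells; for \<open>n < length \<rho>\<close>
  the coefficient vanishes and there is no filling.\<close>

lemma kernel_term_nth:
  assumes \<rho>: "kernel_perm \<rho>"
  shows "(fps_X ^ length \<rho> *
      (\<Sum>rs \<in> weak_comps (num_cells \<rho>) r (num132 \<rho>). \<Sum>v \<in> X \<rho> ((- 1) ^ a).
          fps_const (1 / 2 ^ num_cells \<rho>) * of_int (z \<rho> v) *
          (\<Prod>j = 1..num_cells \<rho>. M (rs j) + (- 1) ^ v j * fps_neg_arg (M (rs j))))) $ n =
    (if even (a + n) then \<Sum>\<tau>\<in>fillings \<rho> r n. rat_of_int (perm_sign (inflate \<rho> \<tau>)) else 0)"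
    (is "(_ * (\<Sum>rs\<in>?W. \<Sum>v\<in>?X. ?P rs v)) $ n = _")
proof (cases "n < length \<rho>")
  case True
  then have "fillings \<rho> r n = {}" by (auto simp: fillings_def)
  with True show ?thesis by (simp add: fps_X_power_mult_nth)
next
  case False
  let ?J = "{1..num_cells \<rho>}"
  let ?G = "\<lambda>rs v. {\<tau>. \<tau> \<in> (\<Pi>\<^sub>E j\<in>?J. parity_perms n (rs j) (v j)) \<and> (\<Sum>j\<in>?J. length (\<tau> j)) = n - length \<rho>}"
  have "?P rs v $ (n - length \<rho>) =
      (\<Sum>\<tau>\<in>?G rs v. of_int (z \<rho> v) * (\<Prod>j\<in>?J. of_int (perm_sign (\<tau> j))))" for rs v
  proof -
    have "?P rs v = fps_const (1 / 2 ^ num_cells \<rho> * of_int (z \<rho> v)) *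
        (\<Prod>j\<in>?J. M (rs j) + (- 1) ^ v j * fps_neg_arg (M (rs j)))"
      by (simp only: fps_of_int flip: fps_const_mult)
    then have "?P rs v $ (n - length \<rho>) = 1 / 2 ^ num_cells \<rho> * of_int (z \<rho> v) *
        (\<Prod>j\<in>?J. M (rs j) + (- 1) ^ v j * fps_neg_arg (M (rs j))) $ (n - length \<rho>)"
      by (simp only: fps_mult_left_const_nth)
    also have "\<dots> = of_int (z \<rho> v) * (\<Sum>\<tau>\<in>?G rs v. \<Prod>j\<in>?J. of_int (perm_sign (\<tau> j)))"
      by (subst prod_parity_parts_nth[where n = n]) auto
    finally show ?thesis by (simp add: sum_distrib_left)
  qed
  moreover have "?G rs v = {\<tau>. \<tau> \<in> (\<Pi>\<^sub>E j\<in>?J. parity_perms n (rs j) (v j)) \<and>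
      length \<rho> + (\<Sum>j\<in>?J. length (\<tau> j)) = n}" for rs v
    using False by auto
  ultimately show ?thesis
    using False sum_parities_fillings[OF \<rho>, of n a r] by (simp add: fps_X_power_mult_nth fps_sum_nth)
qed

theorem theorem8:
  fixes a r :: nat
  assumes "a \<in> {0, 1}"
  shows "fps_const (1 / 2) * (M r + (- 1) ^ a * fps_neg_arg (M r)) - of_bool (r + a = 0) =
    (\<Sum>\<rho> \<in> K (2 * r + 1). fps_X ^ ksize \<rho> *
      (\<Sum>rs \<in> weak_comps (num_cells \<rho>) r (capacity \<rho>).
        \<Sum>v \<in> X \<rho> ((- 1) ^ a).
          fps_const (1 / 2 ^ num_cells \<rho>) * of_int (z \<rho> v) *
          (\<Prod>j = 1..num_cells \<rho>. M (rs j) + (- 1) ^ v j * fps_neg_arg (M (rs j)))))"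
  (is "?L = ?R")
proof (rule fps_ext)
  fix n
  have "((- 1) ^ a :: rat fps) = fps_const ((- 1) ^ a)"
    by (simp flip: fps_const_power fps_const_neg)
  \<comment> \<open>The factor 1/2 cancels the 2 of the parity part: what remains of
    \<open>M r\<close> are its coefficients in degrees of the parity of \<open>a\<close>, up to the
    correction at degree 0.\<close>
  then have L: "?L $ n = (if even (a + n) then M r $ n else 0) - (if n = 0 \<and> r + a = 0 then 1 else 0)"
    by (auto simp: fps_neg_arg_nth minus_one_power_iff)
  have R: "?R $ n = (\<Sum>\<rho>\<in>K (2 * r + 1).
      if even (a + n) then \<Sum>\<tau>\<in>fillings \<rho> r n. rat_of_int (perm_sign (inflate \<rho> \<tau>)) else 0)"
    unfolding fps_sum_nth by (intro sum.cong refl kernel_term_nth) (simp add: K_eq)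
  show "?L $ n = ?R $ n"
  proof (cases "n = 0")
    case True
    \<comment> \<open>Kernels have at least one entry, so the right-hand side has no constant term.
      On the left, the empty permutation contributes 1 exactly if \<open>r = 0\<close> and
      \<open>a = 0\<close>, and the Kronecker delta removes it.\<close>
    have "fillings \<rho> r 0 = {}" if "\<rho> \<in> K (2 * r + 1)" for \<rho>
      using that by (auto simp: K_eq fillings_def kernel_perm_def)
    moreover have "M r $ 0 = (if r = 0 then 1 else 0)"
    proof -
      have "occ132 [] = {}" "inversions [] = {}" by (auto simp: occ132_def inversions_def)
      then have nil: "num132 [] = 0" "perm_sign [] = 1" by (simp_all add: num132_def perm_sign_def)
      then have "{\<tau>. is_perm \<tau> \<and> length \<tau> = 0 \<and> num132 \<tau> = r} = (if r = 0 then {[]} else {})"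
        by (auto simp: is_perm_iff)
      then show ?thesis by (simp add: M_nth nil)
    qed
    ultimately show ?thesis unfolding L R using assms True by auto
  next
    case False
    then show ?thesis unfolding L R using sum_over_kernels[of n r] by auto
  qed
qed

end
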